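(* For every $d\ge3$, the excursion set of the Gaussian free field on $\mathbb{Z}^d$ undergoes a non-trivial percolation phase transition, i.e. $$0\le h_*(d)<\infty ,$$ and, for $h\in\mathbb{R}$, $$\mathbb{P}\big[E_\varphi^{\ge h}\text{ contains an infinite cluster}\big]=\begin{cases}1,&\text{if }h<h_*(d),\\0,&\text{if }h>h_*(d).\end{cases}$$
   Context: $\mathbb{Z}^d$, $d\ge3$, carries the nearest-neighbor graph structure. Let $g(x,y)=\sum_{n\ge0}P_x[X_n=y]$ be the Green function of discrete-time simple random walk on $\mathbb{Z}^d$. $\mathbb{P}$ is the law on $\mathbb{R}^{\mathbb{Z}^d}$ under which the canonical field $\varphi=(\varphi_x)_{x\in\mathbb{Z}^d}$ is a centered Gaussian field with covariance $\mathbb{E}[\varphi_x\varphi_y]=g(x,y)$. For $h\in\mathbb{R}$, $E_\varphi^{\ge h}=\{x\in\mathbb{Z}^d:\varphi_x\ge h\}$; a cluster of $E_\varphi^{\ge h}$ is a connected component of the subgraph it induces. $\{0\stackrel{\ge h}{\longleftrightarrow}\infty\}$ is the event that the origin lies in an infinite cluster of $E_\varphi^{\ge h}$, $\eta(h)=\mathbb{P}[0\stackrel{\ge h}{\longleftrightarrow}\infty]$, and $h_*(d)=\inf\{h\in\mathbb{R}:\eta(h)=0\}\in[-\infty,\infty]$ (with $\inf\emptyset=\infty$). *)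

theory Defs
  imports "HOL-Probability.Probability"
begin

text \<open>The lattice is the type \<open>int ^ 'd\<close>, of dimension \<open>CARD('d)\<close>.\<close>

definition adjacent :: "int ^ 'd \<Rightarrow> int ^ 'd \<Rightarrow> bool" where
  "adjacent x y \<longleftrightarrow> (\<Sum>i\<in>UNIV. \<bar>x $ i - y $ i\<bar>) = 1"

text \<open>\<open>srw x n\<close> is the law of \<open>X\<^sub>n\<close> under \<open>P\<^sub>x\<close>; the set of neighbours of a point is
  finite and nonempty, so \<^const>\<open>pmf_of_set\<close> is the uniform law on it.\<close>

primrec srw :: "int ^ 'd \<Rightarrow> nat \<Rightarrow> (int ^ 'd) pmf" where
  "srw x 0 = return_pmf x"
| "srw x (Suc n) = bind_pmf (srw x n) (\<lambda>z. pmf_of_set {w. adjacent z w})"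

text \<open>The series converges exactly when the walk is transient, i.e. when \<open>CARD('d) \<ge> 3\<close>;
  outside this range the value is unspecified.\<close>

definition green :: "int ^ 'd \<Rightarrow> int ^ 'd \<Rightarrow> real" where
  "green x y = (\<Sum>n. pmf (srw x n) y)"

text \<open>Constants count as (degenerate) Gaussian variables, as is needed for linear combinations
  with vanishing coefficients.\<close>

definition gaussian_rv :: "'a measure \<Rightarrow> ('a \<Rightarrow> real) \<Rightarrow> bool" where
  "gaussian_rv M X \<longleftrightarrow> X \<in> borel_measurable M \<and>
     ((\<exists>\<mu> \<sigma>. \<sigma> > 0 \<and> distributed M lborel X (normal_density \<mu> \<sigma>)) \<or>
      (\<exists>c. AE \<omega> in M. X \<omega> = c))"

definition centered_gaussian_field :: "'a measure \<Rightarrow> ('i \<Rightarrow> 'a \<Rightarrow> real) \<Rightarrow> bool" where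
  "centered_gaussian_field M X \<longleftrightarrow>
     prob_space M \<and>
     (\<forall>S a. finite S \<longrightarrow> gaussian_rv M (\<lambda>\<omega>. \<Sum>x\<in>S. a x * X x \<omega>)) \<and>
     (\<forall>x. (\<integral>\<omega>. X x \<omega> \<partial>M) = 0)"

text \<open>These conditions determine \<open>P\<close> uniquely, since they fix its finite-dimensional marginals.\<close>

definition gff_law :: "(int ^ 'd \<Rightarrow> real) measure \<Rightarrow> bool" where
  "gff_law P \<longleftrightarrow>
     sets P = sets (Pi\<^sub>M UNIV (\<lambda>_. borel)) \<and>
     centered_gaussian_field P (\<lambda>x \<phi>. \<phi> x) \<and>
     (\<forall>x y. (\<integral>\<phi>. \<phi> x * \<phi> y \<partial>P) = green x y)"

definition excursion_set :: "real \<Rightarrow> (int ^ 'd \<Rightarrow> real) \<Rightarrow> (int ^ 'd) set" where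
  "excursion_set h \<phi> = {x. \<phi> x \<ge> h}"

definition induced_edges :: "(int ^ 'd) set \<Rightarrow> (int ^ 'd) rel" where
  "induced_edges E = {(x, y). x \<in> E \<and> y \<in> E \<and> adjacent x y}"

definition connected_in :: "(int ^ 'd) set \<Rightarrow> (int ^ 'd) rel" where
  "connected_in E = {(x, y). x \<in> E \<and> y \<in> E \<and> (x, y) \<in> (induced_edges E)\<^sup>*}"

definition clusters :: "(int ^ 'd) set \<Rightarrow> (int ^ 'd) set set" where
  "clusters E = E // connected_in E"

text \<open>The two sets below are measurable, since the lattice is countable and connectivity is a
  countable union over finite paths; so \<^const>\<open>measure\<close> gives their actual probability.\<close>

definition origin_percolates :: "(int ^ 'd \<Rightarrow> real) measure \<Rightarrow> real \<Rightarrow> (int ^ 'd \<Rightarrow> real) set" where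
  "origin_percolates P h =
     {\<phi> \<in> space P. \<exists>C \<in> clusters (excursion_set h \<phi>). 0 \<in> C \<and> infinite C}"

definition has_infinite_cluster :: "(int ^ 'd \<Rightarrow> real) measure \<Rightarrow> real \<Rightarrow> (int ^ 'd \<Rightarrow> real) set" where
  "has_infinite_cluster P h =
     {\<phi> \<in> space P. \<exists>C \<in> clusters (excursion_set h \<phi>). infinite C}"

definition eta :: "(int ^ 'd \<Rightarrow> real) measure \<Rightarrow> real \<Rightarrow> real" where
  "eta P h = measure P (origin_percolates P h)"

text \<open>In \<^typ>\<open>ereal\<close> the infimum of the empty set is \<open>\<infinity>\<close>.\<close>

definition h_star :: "(int ^ 'd \<Rightarrow> real) measure \<Rightarrow> ereal" where
  "h_star P = Inf (ereal ` {h. eta P h = 0})"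

end

theory Submission imports Defs begin

text \<open>
  The field enters through three facts: every finite linear combination \<open>W\<close> of its values is a
  centered Gaussian, so its characteristic function is \<open>exp (- E W\<^sup>2 / 2)\<close>; the covariance is the
  Green function, which is translation invariant and decays like a negative power of the distance;
  and the Green function is harmonic off the diagonal, which makes the field Markovian.

  \<^bold>\<open>Decay.\<close> A positive strictly superharmonic function bounds all partial sums of the Green series by
  the maximum principle. In dimension at least \<open>3\<close> the function \<open>(\<bar>y\<bar>\<^sup>2 + R) powr (-1/4)\<close> is one for
  large \<open>R\<close>. It gives transience and the decay \<open>\<bar>y\<bar> powr (-1/2)\<close> at once
  (\<open>lyapunov_superharmonic\<close>, \<open>green_function_properties\<close>). This decay is far from optimal, but any
  power suffices below.

  \<^bold>\<open>Uniqueness of laws.\<close> Characteristic functions of finite linear combinations determine all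
  finite-dimensional marginals, also in the presence of a bounded complex weight
  (\<open>cylinder_law_determined\<close>). Translation invariance of \<open>P\<close>, independence of uncorrelated parts and
  the zero-one law are all read off from characteristic functions by means of this lemma.

  \<^bold>\<open>Finite critical level.\<close> A connected set of diameter \<open>16 ^ (n + 1)\<close> contains two
  connected pieces of diameter \<open>16 ^ n\<close> at distance comparable to \<open>16 ^ n\<close>. By iteration a connected set of
  diameter \<open>16 ^ n\<close> contains \<open>2 ^ n\<close> points that are well spread at all scales, and for a given starting cell
  these form one of only \<open>L ^ (2 ^ n)\<close> sets, \<open>L\<close> depending on the dimension only. Because the points are well
  spread, the sum of the field over them has variance of order \<open>2 ^ n\<close>, as for independent variables.
  All of them exceed \<open>h\<close> with probability at most \<open>exp (- c h\<^sup>2 2 ^ n)\<close>, which beats the entropy once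
  \<open>h\<close> is large (\<open>eta_zero_high_level\<close>).

  \<^bold>\<open>Nonnegative critical level.\<close> Suppose that the origin does not percolate at level \<open>h\<close>. Exploring
  from a large sphere the clusters above \<open>h\<close> that touch it, one ends up with an unexplored region
  around the origin on whose boundary the field is below \<open>h\<close>. By the Markov property the field at the
  origin then has conditional mean at most \<open>h\<close>. As the sphere grows, this event exhausts the
  probability space, so \<open>0 = E \<phi>\<^sub>0 \<le> h\<close> (\<open>eta_zero_imp_nonneg\<close>).

  \<^bold>\<open>Zero-one law.\<close> Correlations vanish at infinity, so translates of \<open>exp (i W)\<close> along a sparse sequence
  are nearly orthogonal after centering and their averages tend to \<open>0\<close> in mean square. Testing the
  averages against a translation invariant event shows that the event is independent of the whole field,
  in particular of itself (\<open>zero_one_law\<close>). The existence of an infinite cluster is such an event.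
\<close>

section \<open>The lattice and the Green function\<close>
definition l1 :: "int ^ 'd \<Rightarrow> int" where
  "l1 x = (\<Sum>i\<in>UNIV. \<bar>x $ i\<bar>)"

definition neighbours :: "int ^ 'd \<Rightarrow> (int ^ 'd) set" where
  "neighbours x = {y. adjacent x y}"

lemma l1_nonneg [simp]: "0 \<le> l1 x"
  by (simp add: l1_def sum_nonneg)

lemma l1_zero [simp]: "l1 0 = 0"
  by (simp add: l1_def)

lemma l1_minus_commute: "l1 (x - y) = l1 (y - x)"
  by (simp add: l1_def abs_minus_commute)

lemma l1_triangle: "l1 (x + y) \<le> l1 x + l1 y"
  by (simp add: l1_def flip: sum.distrib) (intro sum_mono, simp)

lemma l1_triangle_minus: "l1 (x - z) \<le> l1 (x - y) + l1 (y - z)"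
  using l1_triangle[of "x - y" "y - z"] by simp

lemma abs_component_le_l1: "\<bar>x $ i\<bar> \<le> l1 x"
  unfolding l1_def by (rule member_le_sum) auto

lemma l1_axis [simp]: "l1 (axis i c) = \<bar>c\<bar>"
proof -
  have "l1 (axis i c) = (\<Sum>j\<in>UNIV. if j = i then \<bar>c\<bar> else 0)"
    unfolding l1_def by (rule sum.cong) (auto simp: axis_def)
  thus ?thesis by simp
qed

lemma adjacent_iff_l1: "adjacent x y \<longleftrightarrow> l1 (x - y) = 1"
  by (simp add: adjacent_def l1_def)

lemma adjacent_sym: "adjacent x y \<longleftrightarrow> adjacent y x"
  by (simp add: adjacent_iff_l1 l1_minus_commute[of x])

lemma adjacent_shift [simp]: "adjacent (x + v) (y + v) \<longleftrightarrow> adjacent x y"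
  by (simp add: adjacent_def)

lemma finite_l1_ball [simp]: "finite {x :: int ^ 'd. l1 x \<le> N}"
proof -
  have "{x :: int ^ 'd. l1 x \<le> N} \<subseteq> vec_lambda ` (PiE UNIV (\<lambda>_. {-N..N}))"
  proof
    fix x :: "int ^ 'd" assume "x \<in> {x. l1 x \<le> N}"
    hence "x $ i \<in> {-N..N}" for i
      using abs_component_le_l1[of x i] by auto
    hence "x = vec_lambda (\<lambda>i. x $ i) \<and> (\<lambda>i. x $ i) \<in> PiE UNIV (\<lambda>_. {-N..N})"
      by (auto simp: vec_eq_iff)
    thus "x \<in> vec_lambda ` (PiE UNIV (\<lambda>_. {-N..N}))" by blast
  qed
  thus ?thesis by (rule finite_subset) (intro finite_imageI finite_PiE, auto)
qed

lemma l1_eq_1E: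
  assumes "l1 x = 1"
  obtains i e where "e \<in> {1, -1}" "x = axis i e"
proof -
  have "x \<noteq> 0" using assms by auto
  then obtain i where i: "x $ i \<noteq> 0" by (auto simp: vec_eq_iff)
  have *: "\<bar>x $ i\<bar> + (\<Sum>j\<in>UNIV - {i}. \<bar>x $ j\<bar>) = 1"
    using assms unfolding l1_def by (subst (asm) sum.remove[of _ i]) auto
  have "(\<Sum>j\<in>UNIV - {i}. \<bar>x $ j\<bar>) \<ge> 0" by (rule sum_nonneg) auto
  hence 1: "\<bar>x $ i\<bar> = 1" and "(\<Sum>j\<in>UNIV - {i}. \<bar>x $ j\<bar>) = 0" using i * by linarith+
  hence "\<forall>j\<in>UNIV - {i}. x $ j = 0" by (subst (asm) sum_nonneg_eq_0_iff) auto
  hence "x = axis i (x $ i)" by (auto simp: vec_eq_iff axis_def)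
  thus ?thesis using that 1 by (metis abs_eq_iff' insert_iff)
qed

lemma neighbours_eq: "neighbours x = (\<lambda>(i, e). x + axis i e) ` (UNIV \<times> {1, -1})"
proof -
  have "y \<in> (\<lambda>(i, e). x + axis i e) ` (UNIV \<times> {1, -1})" if y: "l1 (y - x) = 1" for y
  proof -
    obtain i e where "e \<in> {1, -1}" "y - x = axis i e" by (rule l1_eq_1E[OF y])
    hence "y = (\<lambda>(i, e). x + axis i e) (i, e)" by (simp add: algebra_simps)
    thus ?thesis using \<open>e \<in> {1, -1}\<close> by blast
  qed
  moreover have "l1 (axis i e) = 1" if "e \<in> {1, -1}" for i and e :: int
    using that by auto
  ultimately show ?thesis
    by (fastforce simp: neighbours_def adjacent_iff_l1 l1_minus_commute[of x])
qed

lemma inj_on_axis: "inj_on (\<lambda>(i, e). x + axis i e) (UNIV \<times> {1, -1 :: int})"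
  by (auto simp: inj_on_def axis_eq_axis)

lemma finite_neighbours [simp]: "finite (neighbours x)"
  by (simp add: neighbours_eq)

lemma card_neighbours: "card (neighbours (x :: int ^ 'd)) = 2 * CARD('d)"
proof -
  have "card (neighbours x) = card ((UNIV :: 'd set) \<times> {1, -1 :: int})"
    unfolding neighbours_eq by (rule card_image[OF inj_on_axis])
  thus ?thesis by (simp add: card_cartesian_product)
qed

lemma sum_neighbours:
  "(\<Sum>y\<in>neighbours x. f y) = (\<Sum>i\<in>UNIV. f (x + axis i 1) + f (x + axis i (-1)))"
proof -
  have "(\<Sum>y\<in>neighbours x. f y) = (\<Sum>(i, e)\<in>UNIV \<times> {1, -1}. f (x + axis i e))"
    unfolding neighbours_eq by (subst sum.reindex[OF inj_on_axis]) (simp add: case_prod_unfold)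
  also have "\<dots> = (\<Sum>i\<in>UNIV. \<Sum>e\<in>{1, -1}. f (x + axis i e))"
    by (rule sum.cartesian_product[symmetric])
  finally show ?thesis by simp
qed

lemma neighbours_sym: "y \<in> neighbours x \<longleftrightarrow> x \<in> neighbours y"
  by (simp add: neighbours_def adjacent_sym)

lemma neighbours_nonempty [simp]: "neighbours x \<noteq> {}"
  by (auto simp: neighbours_eq)

lemma neighbours_shift: "neighbours (x + v) = (\<lambda>y. y + v) ` neighbours x"
  by (auto simp: neighbours_eq image_iff algebra_simps)

definition neighbour_mean :: "(int ^ 'd \<Rightarrow> real) \<Rightarrow> int ^ 'd \<Rightarrow> real" where
  "neighbour_mean f x = (\<Sum>y\<in>neighbours x. f y) / real (card (neighbours x))"

lemma pmf_srw_Suc: "pmf (srw x (Suc n)) y = neighbour_mean (\<lambda>z. pmf (srw x n) z) y"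
proof -
  have "pmf (srw x (Suc n)) y =
      (\<integral>z. pmf (pmf_of_set (neighbours z)) y \<partial>srw x n)"
    by (simp add: pmf_bind neighbours_def)
  also have "\<dots> = (\<integral>z. (indicator (neighbours y) z / real (card (neighbours y))) \<partial>srw x n)"
    by (intro integral_cong_AE) 
       (auto simp: indicator_def neighbours_sym[of y] card_neighbours)
  also have "\<dots> = (\<integral>z. indicator (neighbours y) z \<partial>srw x n) / real (card (neighbours y))"
    by simp
  also have "(\<integral>z. indicator (neighbours y) z \<partial>srw x n) = (\<Sum>z\<in>neighbours y. pmf (srw x n) z)"
    by (simp add: measure_measure_pmf_finite)
  finally show ?thesis by (simp add: neighbour_mean_def)
qed

lemma neighbour_mean_mono:
  "(\<And>y. y \<in> neighbours x \<Longrightarrow> f y \<le> g y) \<Longrightarrow> neighbour_mean f x \<le> neighbour_mean g x"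
  unfolding neighbour_mean_def by (intro divide_right_mono sum_mono) auto

lemma neighbour_mean_shift:
  "neighbour_mean f (x + v) = neighbour_mean (\<lambda>y. f (y + v)) x"
proof -
  have "(\<Sum>y\<in>neighbours (x + v). f y) = (\<Sum>y\<in>neighbours x. f (y + v))"
    unfolding neighbours_shift by (subst sum.reindex) (auto simp: inj_on_def)
  thus ?thesis by (simp add: neighbour_mean_def card_neighbours)
qed

lemma pmf_srw_shift: "pmf (srw (x + v) n) (y + v) = pmf (srw x n) y"
proof (induction n arbitrary: y)
  case 0
  show ?case by (simp add: indicator_def)
next
  case (Suc n)
  show ?case by (simp only: pmf_srw_Suc neighbour_mean_shift Suc.IH)
qed

lemma green_shift: "green (x + v) (y + v) = green x y"
  by (simp add: green_def pmf_srw_shift)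

lemma sum_pmf_srw_Suc:
  "(\<Sum>n<Suc N. pmf (srw x n) y) =
     of_bool (x = y) + neighbour_mean (\<lambda>z. \<Sum>n<N. pmf (srw x n) z) y"
proof -
  have "(\<Sum>n<Suc N. pmf (srw x n) y) = of_bool (x = y) + (\<Sum>n<N. pmf (srw x (Suc n)) y)"
    by (subst sum.lessThan_Suc_shift) (simp add: indicator_def)
  also have "(\<Sum>n<N. pmf (srw x (Suc n)) y) = neighbour_mean (\<lambda>z. \<Sum>n<N. pmf (srw x n) z) y"
    by (simp only: pmf_srw_Suc neighbour_mean_def flip: sum_divide_distrib) (subst sum.swap, rule refl)
  finally show ?thesis .
qed

text \<open>\<open>F\<close> is a supersolution of the equation that the partial sums of the Green series satisfy in the
  recursion \<open>sum_pmf_srw_Suc\<close>, so it dominates them by induction on their number of terms.\<close>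
lemma green_le_supersolution:
  assumes F: "\<And>y. F y \<ge> of_bool (y = 0) + neighbour_mean F y" and F0: "\<And>y. F y \<ge> 0"
  shows "summable (\<lambda>n. pmf (srw x n) y)" "green x y \<le> F (y - x)"
proof -
  have *: "(\<Sum>n<N. pmf (srw x n) y) \<le> F (y - x)" for N y
  proof (induction N arbitrary: y)
    case 0
    show ?case by (simp add: F0)
  next
    case (Suc N)
    have "(\<Sum>n<Suc N. pmf (srw x n) y) \<le> of_bool (x = y) + neighbour_mean (\<lambda>z. F (z - x)) y"
      unfolding sum_pmf_srw_Suc by (intro add_left_mono neighbour_mean_mono Suc.IH)
    also have "\<dots> = of_bool (y - x = 0) + neighbour_mean F (y - x)"
      using neighbour_mean_shift[of F y "- x"] by auto
    also have "\<dots> \<le> F (y - x)" by (rule F)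
    finally show ?case .
  qed
  show s: "summable (\<lambda>n. pmf (srw x n) y)"
    by (rule bounded_imp_summable[where B = "F (y - x)"])
       (use * [where N="Suc _"] in \<open>auto simp: lessThan_Suc_atMost\<close>)
  show "green x y \<le> F (y - x)"
    unfolding green_def by (rule suminf_le_const[OF s *])
qed

lemma green_harmonic:
  assumes "\<And>y. summable (\<lambda>n. pmf (srw x n) y)"
  shows "green x y = of_bool (x = y) + neighbour_mean (green x) y"
proof -
  have "(\<lambda>N. \<Sum>n<Suc N. pmf (srw x n) y) \<longlonglongrightarrow> green x y"
    unfolding green_def by (rule LIMSEQ_Suc) (rule summable_LIMSEQ[OF assms])
  moreover have "(\<lambda>N. \<Sum>n<Suc N. pmf (srw x n) y) \<longlonglongrightarrow> of_bool (x = y) + neighbour_mean (green x) y"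
    unfolding sum_pmf_srw_Suc neighbour_mean_def
    by (intro tendsto_intros) (auto simp: green_def card_neighbours intro!: summable_LIMSEQ[OF assms])
  ultimately show ?thesis by (rule LIMSEQ_unique)
qed

text \<open>A quadratic upper bound whose second-order coefficient \<open>9/50\<close> lies strictly between the Taylor
  coefficient \<open>5/32\<close> and the value \<open>3/16\<close> that superharmonicity in dimension \<open>3\<close> tolerates. The bound is
  equivalent to a polynomial inequality after taking fourth powers.\<close>
lemma powr_quarter_bound:
  fixes u :: real
  assumes "\<bar>u\<bar> \<le> 1/100"
  shows "(1 + u) powr (-1/4) \<le> 1 - u/4 + 9/50 * u\<^sup>2"
proof -
  define v where "v = 1 - u/4 + 9/50 * u\<^sup>2"
  have u: "u \<ge> -1/100" "u \<le> 1/100" using assms by auto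
  have v0: "v > 0" unfolding v_def using u by (simp add: add_pos_nonneg)
  \<comment> \<open>\<open>(1 + u) * v ^ 4 = 1 + u\<^sup>2 * (19/200 + u * r)\<close>; the coefficient of \<open>u\<^sup>2\<close> is positive because
    \<open>9/50 > 5/32\<close>, and \<open>r\<close> collects the higher-order terms in Horner form.\<close>
  define r where "r = 197/400 + u * (-43071/160000 + u * (35977/160000 + u * (-18243/250000 +
    u * (14823/500000 + u * (-29889/6250000 + u * (6561/6250000))))))"
  have step: "\<bar>a + u * b\<bar> \<le> 1" if "\<bar>a\<bar> \<le> 1/2" "\<bar>b\<bar> \<le> 1" for a b :: real
    using that assms mult_mono[of "\<bar>u\<bar>" "1/100" "\<bar>b\<bar>" 1] abs_triangle_ineq[of a "u * b"]
    by (simp add: abs_mult)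
  have "\<bar>r\<bar> \<le> 1"
    unfolding r_def by (intro step) auto
  hence "\<bar>u * r\<bar> \<le> 1/100"
    using assms mult_mono[of "\<bar>u\<bar>" "1/100" "\<bar>r\<bar>" 1] by (simp add: abs_mult)
  hence "19/200 + u * r \<ge> 0" by linarith
  moreover have "(1 + u) * v ^ 4 = 1 + u\<^sup>2 * (19/200 + u * r)"
    unfolding v_def r_def by (simp add: field_simps power2_eq_square eval_nat_numeral)
  ultimately have "(1 + u) * v ^ 4 \<ge> 1" by simp
  hence "1 / (1 + u) \<le> v ^ 4" using u by (simp add: field_simps)
  hence "(1 / (1 + u)) powr (1/4) \<le> (v ^ 4) powr (1/4)"
    using u by (intro powr_mono2) auto
  also have "(v ^ 4) powr (1/4) = v"
    using v0 by (simp add: powr_powr flip: powr_numeral)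
  also have "(1 / (1 + u)) powr (1/4) = (1 + u) powr (-1/4)"
    using u powr_minus_divide[of "1 + u" "1/4"] by (simp add: powr_divide)
  finally show ?thesis by (simp add: v_def)
qed

text \<open>The exponent \<open>1/4\<close> is less than \<open>d / 2 - 1\<close> for all \<open>d \<ge> 3\<close>, which is what superharmonicity of
  \<open>\<bar>y\<bar> powr (-1/2)\<close> at infinity requires. The shift keeps the relative increments of the
  base between neighbours of size at most \<open>1/100\<close> and absorbs the terms of order \<open>d\<close>.\<close>
definition lyapunov :: "int ^ 'd \<Rightarrow> real" where
  "lyapunov y = ((\<Sum>i\<in>UNIV. (real_of_int (y $ i))\<^sup>2) + (10100 + real CARD('d))) powr (-1/4)"

lemma sum_sq_axis:
  "(\<Sum>j\<in>UNIV. (real_of_int ((y + axis i e) $ j))\<^sup>2) =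
     (\<Sum>j\<in>UNIV. (real_of_int (y $ j))\<^sup>2) + 2 * real_of_int e * real_of_int (y $ i) + (real_of_int e)\<^sup>2"
proof -
  have "(\<Sum>j\<in>UNIV. (real_of_int ((y + axis i e) $ j))\<^sup>2) =
      (\<Sum>j\<in>UNIV. (real_of_int (y $ j))\<^sup>2 + (if j = i then 2 * real_of_int e * real_of_int (y $ i) + (real_of_int e)\<^sup>2 else 0))"
    by (rule sum.cong) (auto simp: axis_def power2_sum)
  thus ?thesis by (simp add: sum.distrib)
qed

text \<open>With \<open>s\<close> the base of the power at \<open>y\<close>, the bound \<open>powr_quarter_bound\<close> leaves, after summation over the
  neighbours, a first-order term \<open>- d / (2 s)\<close> against a second-order term of at most \<open>(36/25) / s\<close>; the
  former wins since \<open>36/25 < 3/2 \<le> d / 2\<close>.\<close>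
lemma lyapunov_superharmonic:
  fixes y :: "int ^ 'd"
  assumes d: "CARD('d) \<ge> 3"
  shows "neighbour_mean lyapunov y < lyapunov y"
proof -
  define q where "q = (\<Sum>i\<in>UNIV. (real_of_int (y $ i))\<^sup>2)"
  define n where "n = real CARD('d)"
  define s where "s = q + (10100 + n)"
  define t where "t i = real_of_int (y $ i)" for i
  have n: "n \<ge> 3" using d by (simp add: n_def)
  have q0: "q \<ge> 0" unfolding q_def by (intro sum_nonneg) auto
  have s0: "s > 0" using q0 n by (simp add: s_def)
  have tq: "(t i)\<^sup>2 \<le> q" for i
    unfolding q_def t_def by (rule member_le_sum) auto
  have nb: "lyapunov (y + axis i e) \<le>
      s powr (-1/4) * (1 - ((1 + 2 * e * t i) / s) / 4 + 9/50 * ((1 + 2 * e * t i) / s)\<^sup>2)"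
    if e: "e \<in> {1, -1}" for i e
  proof -
    define u where "u = (1 + 2 * e * t i) / s"
    \<comment> \<open>This square gives \<open>1 + 2 * \<bar>t i\<bar> \<le> ((t i)\<^sup>2 + 10100) / 100\<close>.\<close>
    have "(\<bar>t i\<bar> - 100)\<^sup>2 \<ge> 0" by simp
    hence "1 + 2 * \<bar>t i\<bar> \<le> s / 100"
      using tq[of i] n by (simp add: s_def power2_eq_square algebra_simps abs_if split: if_splits)
    moreover have "\<bar>1 + 2 * e * t i\<bar> \<le> 1 + 2 * \<bar>t i\<bar>" using e by auto
    ultimately have "\<bar>1 + 2 * e * t i\<bar> \<le> s / 100" by linarith
    hence u: "\<bar>u\<bar> \<le> 1/100" using s0 by (simp add: u_def field_simps)
    have "lyapunov (y + axis i e) = (s + 1 + 2 * e * t i) powr (-1/4)"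
      unfolding lyapunov_def sum_sq_axis using e
      by (auto simp: s_def q_def n_def t_def algebra_simps)
    also have "s + 1 + 2 * e * t i = s * (1 + u)" using s0 by (simp add: u_def field_simps)
    also have "\<dots> powr (-1/4) = s powr (-1/4) * (1 + u) powr (-1/4)"
      using s0 u by (intro powr_mult)
    also have "\<dots> \<le> s powr (-1/4) * (1 - u/4 + 9/50 * u\<^sup>2)"
      by (intro mult_left_mono powr_quarter_bound u) auto
    finally show ?thesis by (simp add: u_def)
  qed
  have "(\<Sum>z\<in>neighbours y. lyapunov z) \<le>
      (\<Sum>i\<in>UNIV. s powr (-1/4) * (1 - ((1 + 2 * 1 * t i) / s) / 4 + 9/50 * ((1 + 2 * 1 * t i) / s)\<^sup>2) +
                 s powr (-1/4) * (1 - ((1 + 2 * (-1) * t i) / s) / 4 + 9/50 * ((1 + 2 * (-1) * t i) / s)\<^sup>2))"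
    unfolding sum_neighbours using nb[of 1] nb[of "-1"] by (intro sum_mono add_mono) auto
  also have "\<dots> = (\<Sum>i\<in>UNIV. s powr (-1/4) * (2 - 1 / (2 * s) + 9/25 / s\<^sup>2) + s powr (-1/4) * (36/25 / s\<^sup>2) * (t i)\<^sup>2)"
    using s0 by (intro sum.cong) (auto simp: field_simps power2_eq_square)
  also have "\<dots> = s powr (-1/4) * (n * (2 - 1 / (2 * s) + 9/25 / s\<^sup>2)) + s powr (-1/4) * (36/25 / s\<^sup>2) * q"
    unfolding sum.distrib q_def t_def sum_distrib_left[symmetric] n_def
    by (simp del: add_divide_distrib add: algebra_simps)
  also have "\<dots> = s powr (-1/4) * (2 * n + (36/25 * q + 9/25 * n - n * s / 2) / s\<^sup>2)"
    using s0 by (simp add: field_simps power2_eq_square)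
  also have "\<dots> < s powr (-1/4) * (2 * n + 0)"
  proof (intro mult_strict_left_mono add_strict_left_mono)
    have "36/25 * q + 9/25 * n < 3 / 2 * s" using q0 n by (simp add: s_def)
    also have "\<dots> \<le> n / 2 * s" using n s0 by (intro mult_right_mono) auto
    finally show "(36/25 * q + 9/25 * n - n * s / 2) / s\<^sup>2 < 0"
      using s0 by (intro divide_neg_pos) auto
  qed (use s0 in auto)
  finally have "(\<Sum>z\<in>neighbours y. lyapunov z) < 2 * n * lyapunov y"
    by (simp add: lyapunov_def s_def q_def n_def mult_ac)
  thus ?thesis using n by (simp add: neighbour_mean_def card_neighbours n_def field_simps)
qed

text \<open>Scales are powers of \<open>16\<close>, for which the decay exponent \<open>1/2\<close> yields powers of \<open>4\<close>.\<close>
lemma lyapunov_decay: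
  fixes y :: "int ^ 'd"
  assumes "l1 y \<ge> 16 ^ k"
  shows "lyapunov y \<le> real CARD('d) / 4 ^ k"
proof -
  define n where "n = real CARD('d)"
  have n: "n \<ge> 1" by (simp add: n_def Suc_leI)
  have "real_of_int (l1 y) = (\<Sum>i\<in>UNIV. \<bar>real_of_int (y $ i)\<bar> * 1)" by (simp add: l1_def)
  also have "(\<dots>)\<^sup>2 \<le> (\<Sum>i\<in>UNIV. \<bar>real_of_int (y $ i)\<bar>\<^sup>2) * (\<Sum>i\<in>(UNIV :: 'd set). 1\<^sup>2)"
    by (rule Cauchy_Schwarz_ineq_sum)
  finally have "(real_of_int (l1 y))\<^sup>2 / n \<le> (\<Sum>i\<in>UNIV. (real_of_int (y $ i))\<^sup>2)"
    using n by (simp add: n_def field_simps)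
  moreover have "(16 ^ k)\<^sup>2 \<le> (real_of_int (l1 y))\<^sup>2"
  proof (rule power_mono)
    have "real_of_int (16 ^ k) \<le> real_of_int (l1 y)" using assms by (simp only: of_int_le_iff)
    thus "16 ^ k \<le> real_of_int (l1 y)" by simp
  qed simp
  ultimately have "(16 ^ k)\<^sup>2 / n \<le> (\<Sum>i\<in>UNIV. (real_of_int (y $ i))\<^sup>2) + (10100 + n)"
    using n divide_right_mono[of "(16 ^ k)\<^sup>2" "(real_of_int (l1 y))\<^sup>2" n] by linarith
  moreover have "(4 ^ k / n) ^ 4 \<le> (16 ^ k)\<^sup>2 / n"
  proof -
    have "(4 ^ k / n) ^ 4 = ((4 ^ 4) ^ k :: real) / n ^ 4" 
      by (simp only: power_divide power_mult[symmetric] mult.commute[of k])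
    also have "\<dots> \<le> (4 ^ 4) ^ k / n ^ 1"
      using n by (intro divide_left_mono power_increasing) auto
    also have "(4 ^ 4 :: real) ^ k = (16 ^ k)\<^sup>2" by (simp add: power2_eq_square flip: power_mult_distrib)
    finally show ?thesis by simp
  qed
  ultimately have "lyapunov y \<le> ((4 ^ k / n) ^ 4) powr (-1/4)"
    unfolding lyapunov_def n_def[symmetric] using n by (intro powr_mono2') auto
  also have "\<dots> = (4 ^ k / n) powr (-1)"
    using n by (simp add: powr_powr flip: powr_numeral)
  also have "\<dots> = n / 4 ^ k" using n by (simp add: powr_minus_divide)
  finally show ?thesis by (simp add: n_def)
qed

lemma green_function_properties:
  fixes x y :: "int ^ 'd"
  assumes d: "CARD('d) \<ge> 3"
  shows green_eq: "\<And>x y :: int ^ 'd. green x y = of_bool (x = y) + neighbour_mean (green x) y"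
    and green_decay: "\<exists>C > 0. (\<forall>x y :: int ^ 'd. green x y \<le> C) \<and>
        (\<forall>k. \<forall>x y :: int ^ 'd. 16 ^ k \<le> l1 (x - y) \<longrightarrow> green x y \<le> C / 4 ^ k)"
    and green_nonneg: "\<And>x y :: int ^ 'd. green x y \<ge> 0"
proof -
  define c where "c = 1 / (lyapunov (0 :: int ^ 'd) - neighbour_mean lyapunov (0 :: int ^ 'd))"
  define F where "F = (\<lambda>y :: int ^ 'd. c * lyapunov y)"
  have c: "c > 0" unfolding c_def using lyapunov_superharmonic[OF d, of 0] by simp
  have mF: "neighbour_mean F y = c * neighbour_mean lyapunov y" for y
    by (simp add: neighbour_mean_def F_def sum_distrib_left)
  have F: "F y \<ge> of_bool (y = 0) + neighbour_mean F y" for y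
  proof (cases "y = 0")
    case True
    have "c * (lyapunov (0 :: int ^ 'd) - neighbour_mean lyapunov (0 :: int ^ 'd)) = 1"
      using c by (simp add: c_def)
    thus ?thesis unfolding mF using True by (simp add: F_def algebra_simps)
  next
    case False
    thus ?thesis unfolding mF using lyapunov_superharmonic[OF d, of y] c by (simp add: F_def)
  qed
  have F0: "F y \<ge> 0" for y using c by (simp add: F_def lyapunov_def)
  note summ = green_le_supersolution[of F, OF F F0]
  show "green x y = of_bool (x = y) + neighbour_mean (green x) y" for x y :: "int ^ 'd"
    by (rule green_harmonic) (rule summ)
  show "green x y \<ge> 0" for x y :: "int ^ 'd"
    unfolding green_def by (rule suminf_nonneg[OF summ(1)]) simp
  have dec: "green x y \<le> c * real CARD('d) / 4 ^ k" if "16 ^ k \<le> l1 (x - y)" for k and x y :: "int ^ 'd"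
  proof -
    have "green x y \<le> c * lyapunov (y - x)" using summ(2)[of x y] by (simp add: F_def)
    also have "\<dots> \<le> c * (real CARD('d) / 4 ^ k)"
      using that c by (intro mult_left_mono lyapunov_decay) (auto simp: l1_minus_commute)
    finally show ?thesis by simp
  qed
  have bd: "green x y \<le> c" for x y :: "int ^ 'd"
  proof -
    have "green x y \<le> c * lyapunov (y - x)" using summ(2)[of x y] by (simp add: F_def)
    also have "lyapunov (y - x) \<le> 1 powr (-1/4)"
      unfolding lyapunov_def by (intro powr_mono2') (auto intro!: add_increasing sum_nonneg)
    finally show ?thesis using c by simp
  qed
  have n: "real CARD('d) \<ge> 1" by (simp add: Suc_leI)
  show "\<exists>C > 0. (\<forall>x y :: int ^ 'd. green x y \<le> C) \<and>
        (\<forall>k. \<forall>x y :: int ^ 'd. 16 ^ k \<le> l1 (x - y) \<longrightarrow> green x y \<le> C / 4 ^ k)"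
    using c n dec bd by (intro exI[of _ "c * real CARD('d)"]) (auto intro: order.trans[OF bd])
qed

section \<open>Laws determined by characteristic functions\<close>

text \<open>
  Dividing the weights by their common total mass, which is the value of the transforms at \<open>s = 0\<close>,
  turns the weighted measures into probability measures, to which Levy's uniqueness theorem applies.
\<close>
lemma weighted_law_determined:
  fixes w1 :: "'a \<Rightarrow> real" and w2 :: "'b \<Rightarrow> real"
  assumes [measurable]: "X1 \<in> borel_measurable M1" "X2 \<in> borel_measurable M2" "B \<in> sets borel"
    and int: "integrable M1 w1" "integrable M2 w2"
    and nn: "\<And>\<omega>. w1 \<omega> \<ge> 0" "\<And>\<omega>. w2 \<omega> \<ge> 0"
    and eq: "\<And>s. (\<integral>\<omega>. w1 \<omega> *\<^sub>R iexp (s * X1 \<omega>) \<partial>M1) = (\<integral>\<omega>. w2 \<omega> *\<^sub>R iexp (s * X2 \<omega>) \<partial>M2)"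
  shows "(\<integral>\<omega>. w1 \<omega> * indicator B (X1 \<omega>) \<partial>M1) = (\<integral>\<omega>. w2 \<omega> * indicator B (X2 \<omega>) \<partial>M2)"
proof -
  note [measurable] = borel_measurable_integrable[OF int(1)] borel_measurable_integrable[OF int(2)]
  define m where "m = integral\<^sup>L M1 w1"
  have m2: "integral\<^sup>L M2 w2 = m"
    using eq[of 0] unfolding m_def by (simp add: of_real_def[symmetric] del: of_real_def)
  show ?thesis
  proof (cases "m = 0")
    case True
    have "AE \<omega> in M1. w1 \<omega> = 0" "AE \<omega> in M2. w2 \<omega> = 0"
      using integral_nonneg_eq_0_iff_AE[OF int(1)] integral_nonneg_eq_0_iff_AE[OF int(2)] nn m2 True
      by (auto simp: m_def)
    hence "AE \<omega> in M1. w1 \<omega> * indicator B (X1 \<omega>) = 0" "AE \<omega> in M2. w2 \<omega> * indicator B (X2 \<omega>) = 0"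
      by auto
    thus ?thesis by (simp add: integral_eq_zero_AE)
  next
    case False
    have m: "m > 0" using False Bochner_Integration.integral_nonneg[of M1 w1] nn by (auto simp: m_def less_le)
    have *: "real_distribution (distr (density M (\<lambda>\<omega>. ennreal (w \<omega> / m))) borel X) \<and>
        char (distr (density M (\<lambda>\<omega>. ennreal (w \<omega> / m))) borel X) = (\<lambda>s. (\<integral>\<omega>. w \<omega> *\<^sub>R iexp (s * X \<omega>) \<partial>M) / m) \<and>
        measure (distr (density M (\<lambda>\<omega>. ennreal (w \<omega> / m))) borel X) B = (\<integral>\<omega>. w \<omega> * indicator B (X \<omega>) \<partial>M) / m"
      if [measurable]: "X \<in> borel_measurable M" and w: "integrable M w" "\<And>\<omega>. w \<omega> \<ge> 0" "integral\<^sup>L M w = m"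
      for M :: "'c measure" and w :: "'c \<Rightarrow> real" and X
    proof -
      note [measurable] = borel_measurable_integrable[OF w(1)]
      let ?D = "density M (\<lambda>\<omega>. ennreal (w \<omega> / m))"
      have "(\<integral>\<^sup>+\<omega>. ennreal (w \<omega> / m) \<partial>M) = ennreal (\<integral>\<omega>. w \<omega> / m \<partial>M)"
        using w m by (intro nn_integral_eq_integral) auto
      also have "\<dots> = 1" using w m by simp
      finally have D: "prob_space ?D"
        by (intro prob_spaceI) (simp add: emeasure_density cong: nn_integral_cong)
      interpret D: prob_space ?D by fact
      have rd: "real_distribution (distr ?D borel X)"
        using D.prob_space_distr[of X borel] by (simp add: real_distribution_def real_distribution_axioms_def)
      interpret R: real_distribution "distr ?D borel X" by fact
      have "char (distr ?D borel X) s = (\<integral>\<omega>. w \<omega> *\<^sub>R iexp (s * X \<omega>) \<partial>M) / m" for s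
      proof -
        have "char (distr ?D borel X) s = (\<integral>\<omega>. iexp (s * X \<omega>) \<partial>?D)"
          unfolding char_def by (subst integral_distr) auto
        also have "\<dots> = (\<integral>\<omega>. (w \<omega> / m) *\<^sub>R iexp (s * X \<omega>) \<partial>M)"
          using w m by (subst integral_density) auto
        also have "\<dots> = (\<integral>\<omega>. w \<omega> *\<^sub>R iexp (s * X \<omega>) / complex_of_real m \<partial>M)"
          by (rule Bochner_Integration.integral_cong) (auto simp: scaleR_conv_of_real)
        finally show ?thesis by simp
      qed
      moreover have "measure (distr ?D borel X) B = (\<integral>\<omega>. w \<omega> * indicator B (X \<omega>) \<partial>M) / m"
      proof -
        have "measure (distr ?D borel X) B = (\<integral>x. indicator B x \<partial>distr ?D borel X)"
          by simp
        also have "\<dots> = (\<integral>\<omega>. indicator B (X \<omega>) \<partial>?D)"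
          by (subst integral_distr) auto
        also have "\<dots> = (\<integral>\<omega>. (w \<omega> / m) *\<^sub>R indicator B (X \<omega>) \<partial>M)"
          using w m by (subst integral_density) auto
        finally show ?thesis by simp
      qed
      ultimately show ?thesis using rd by auto
    qed
    note 1 = *[OF assms(1) int(1) nn(1) m_def[symmetric]]
    note 2 = *[OF assms(2) int(2) nn(2) m2]
    have "distr (density M1 (\<lambda>\<omega>. ennreal (w1 \<omega> / m))) borel X1 = distr (density M2 (\<lambda>\<omega>. ennreal (w2 \<omega> / m))) borel X2"
      using 1 2 eq by (intro Levy_uniqueness) auto
    thus ?thesis using 1 2 m by auto
  qed
qed

lemma (in prob_space) integrable_bounded_by_1:
  fixes f :: "'a \<Rightarrow> 'b::{banach, second_countable_topology}"
  assumes "f \<in> borel_measurable M" "\<And>\<omega>. norm (f \<omega>) \<le> 1"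
  shows "integrable M f"
  by (rule integrable_const_bound[where B = 1]) (use assms in auto)

text \<open>Complex weights reduce to real ones because conjugation turns the transform at \<open>s\<close> into that at
  \<open>- s\<close>. A real weight \<open>r\<close> with values in \<open>[-1, 1]\<close> reduces to the nonnegative weight \<open>1 + r\<close>, whose
  transform is determined as well because those for the weight \<open>1\<close> agree.\<close>
lemma bounded_weight_law_determined:
  fixes g1 :: "'a \<Rightarrow> complex" and g2 :: "'b \<Rightarrow> complex"
  assumes "prob_space M1" "prob_space M2"
    and [measurable]: "X1 \<in> borel_measurable M1" "X2 \<in> borel_measurable M2" "B \<in> sets borel"
      "g1 \<in> borel_measurable M1" "g2 \<in> borel_measurable M2"
    and bd: "\<And>\<omega>. norm (g1 \<omega>) \<le> 1" "\<And>\<omega>. norm (g2 \<omega>) \<le> 1"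
    and unw: "\<And>s. (\<integral>\<omega>. iexp (s * X1 \<omega>) \<partial>M1) = (\<integral>\<omega>. iexp (s * X2 \<omega>) \<partial>M2)"
    and eq: "\<And>s. (\<integral>\<omega>. g1 \<omega> * iexp (s * X1 \<omega>) \<partial>M1) = (\<integral>\<omega>. g2 \<omega> * iexp (s * X2 \<omega>) \<partial>M2)"
  shows "(\<integral>\<omega>. g1 \<omega> * indicator B (X1 \<omega>) \<partial>M1) = (\<integral>\<omega>. g2 \<omega> * indicator B (X2 \<omega>) \<partial>M2)"
proof -
  interpret M1: prob_space M1 by fact
  interpret M2: prob_space M2 by fact
  have real_weight: "(\<integral>\<omega>. r1 \<omega> * indicator B (X1 \<omega>) \<partial>M1) = (\<integral>\<omega>. r2 \<omega> * indicator B (X2 \<omega>) \<partial>M2)"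
    if [measurable]: "r1 \<in> borel_measurable M1" "r2 \<in> borel_measurable M2"
      and r: "\<And>\<omega>. \<bar>r1 \<omega>\<bar> \<le> 1" "\<And>\<omega>. \<bar>r2 \<omega>\<bar> \<le> 1"
      and req: "\<And>s. (\<integral>\<omega>. r1 \<omega> *\<^sub>R iexp (s * X1 \<omega>) \<partial>M1) = (\<integral>\<omega>. r2 \<omega> *\<^sub>R iexp (s * X2 \<omega>) \<partial>M2)"
    for r1 :: "'a \<Rightarrow> real" and r2 :: "'b \<Rightarrow> real"
  proof -
    have i1: "integrable M1 r1" "integrable M1 (\<lambda>\<omega>. r1 \<omega> *\<^sub>R iexp (s * X1 \<omega>))" "integrable M1 (\<lambda>\<omega>. iexp (s * X1 \<omega>))" 
       "integrable M1 (\<lambda>\<omega>. r1 \<omega> * indicator B (X1 \<omega>))" "integrable M1 (\<lambda>\<omega>. indicator B (X1 \<omega>) :: real)" for s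
      by (rule M1.integrable_bounded_by_1; use r in \<open>auto simp: indicator_def\<close>)+
    have i2: "integrable M2 r2" "integrable M2 (\<lambda>\<omega>. r2 \<omega> *\<^sub>R iexp (s * X2 \<omega>))" "integrable M2 (\<lambda>\<omega>. iexp (s * X2 \<omega>))" 
       "integrable M2 (\<lambda>\<omega>. r2 \<omega> * indicator B (X2 \<omega>))" "integrable M2 (\<lambda>\<omega>. indicator B (X2 \<omega>) :: real)" for s
      by (rule M2.integrable_bounded_by_1; use r in \<open>auto simp: indicator_def\<close>)+
    have "(\<integral>\<omega>. (1 + r1 \<omega>) * indicator B (X1 \<omega>) \<partial>M1) = (\<integral>\<omega>. (1 + r2 \<omega>) * indicator B (X2 \<omega>) \<partial>M2)"
    proof (rule weighted_law_determined)
      show "1 + r1 \<omega> \<ge> 0" "1 + r2 \<omega>' \<ge> 0" for \<omega> \<omega>'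
        using r(1)[of \<omega>] r(2)[of \<omega>'] by auto
      show "(\<integral>\<omega>. (1 + r1 \<omega>) *\<^sub>R iexp (s * X1 \<omega>) \<partial>M1) = (\<integral>\<omega>. (1 + r2 \<omega>) *\<^sub>R iexp (s * X2 \<omega>) \<partial>M2)" for s
        using i1(2,3)[of s] i2(2,3)[of s] unw[of s] req[of s] by (simp add: scaleR_add_left)
    qed (use i1 i2 in auto)
    moreover have "(\<integral>\<omega>. 1 * indicator B (X1 \<omega>) \<partial>M1) = (\<integral>\<omega>. 1 * indicator B (X2 \<omega>) \<partial>M2 :: real)"
      by (rule weighted_law_determined) (use unw in auto)
    ultimately show ?thesis using i1 i2 by (simp add: distrib_right)
  qed
  have cnj_weight: "(\<integral>\<omega>. cnj (g1 \<omega>) * iexp (s * X1 \<omega>) \<partial>M1) = (\<integral>\<omega>. cnj (g2 \<omega>) * iexp (s * X2 \<omega>) \<partial>M2)" for s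
    using arg_cong[OF eq[of "- s"], of cnj]
    by (simp add: exp_cnj flip: Bochner_Integration.integral_cnj)
  have [measurable]: "(\<lambda>\<omega>. cnj (g1 \<omega>)) \<in> borel_measurable M1" "(\<lambda>\<omega>. cnj (g2 \<omega>)) \<in> borel_measurable M2"
    by (auto intro!: measurable_compose[OF _ borel_measurable_continuous_onI[of cnj]] continuous_intros)
  have i1: "integrable M1 (\<lambda>\<omega>. g1 \<omega> * iexp (s * X1 \<omega>))" "integrable M1 (\<lambda>\<omega>. cnj (g1 \<omega>) * iexp (s * X1 \<omega>))"
    "integrable M1 (\<lambda>\<omega>. g1 \<omega> * indicator B (X1 \<omega>))" for s
    by (rule M1.integrable_bounded_by_1, measurable, (simp add: bd norm_mult indicator_def)[1])+
  have i2: "integrable M2 (\<lambda>\<omega>. g2 \<omega> * iexp (s * X2 \<omega>))" "integrable M2 (\<lambda>\<omega>. cnj (g2 \<omega>) * iexp (s * X2 \<omega>))" 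
    "integrable M2 (\<lambda>\<omega>. g2 \<omega> * indicator B (X2 \<omega>))" for s
    by (rule M2.integrable_bounded_by_1, measurable, (simp add: bd norm_mult indicator_def)[1])+
  have ReIm: "Re z *\<^sub>R v = (z * v + cnj z * v) / 2" "Im z *\<^sub>R v = (z * v - cnj z * v) / (2 * \<i>)" for z v :: complex
    by (auto simp: complex_eq_iff scaleR_conv_of_real Re_divide Im_divide power2_eq_square)
  have bd': "\<bar>Re (g1 \<omega>)\<bar> \<le> 1" "\<bar>Im (g1 \<omega>)\<bar> \<le> 1" "\<bar>Re (g2 \<omega>')\<bar> \<le> 1" "\<bar>Im (g2 \<omega>')\<bar> \<le> 1" for \<omega> \<omega>'
    using bd(1)[of \<omega>] bd(2)[of \<omega>'] abs_Re_le_cmod[of "g1 \<omega>"] abs_Im_le_cmod[of "g1 \<omega>"]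
      abs_Re_le_cmod[of "g2 \<omega>'"] abs_Im_le_cmod[of "g2 \<omega>'"] by linarith+
  have "(\<integral>\<omega>. Re (g1 \<omega>) * indicator B (X1 \<omega>) \<partial>M1) = (\<integral>\<omega>. Re (g2 \<omega>) * indicator B (X2 \<omega>) \<partial>M2)"
    by (rule real_weight) (use i1 i2 cnj_weight eq bd' in \<open>auto simp: ReIm\<close>)
  moreover have "(\<integral>\<omega>. Im (g1 \<omega>) * indicator B (X1 \<omega>) \<partial>M1) = (\<integral>\<omega>. Im (g2 \<omega>) * indicator B (X2 \<omega>) \<partial>M2)"
    by (rule real_weight) (use i1 i2 cnj_weight eq bd' in \<open>auto simp: ReIm\<close>)
  moreover have "Re (z * indicator B x) = Re z * indicator B x" "Im (z * indicator B x) = Im z * indicator B x" for z x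
    by (auto simp: indicator_def)
  ultimately show ?thesis
    using i1 i2 by (simp add: complex_eq_iff flip: integral_Re integral_Im)
qed

definition linear_comb :: "('i \<Rightarrow> 'a \<Rightarrow> real) \<Rightarrow> 'i set \<Rightarrow> ('i \<Rightarrow> real) \<Rightarrow> 'a \<Rightarrow> real" where
  "linear_comb X S a \<omega> = (\<Sum>i\<in>S. a i * X i \<omega>)"

lemma measurable_linear_comb [measurable (raw)]:
  assumes "\<And>i. i \<in> S \<Longrightarrow> X i \<in> borel_measurable M"
  shows "linear_comb X S a \<in> borel_measurable M"
  unfolding linear_comb_def[abs_def] using assms by (intro borel_measurable_sum) auto

text \<open>Linear combinations absorb further coordinates, whether or not these already occur. This is what
  the induction in \<open>cylinder_law_determined\<close> feeds back into its hypothesis.\<close>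
lemma linear_comb_insert:
  assumes "finite S"
  shows "linear_comb X S a \<omega> + s * X k \<omega> =
    linear_comb X (insert k S) (\<lambda>i. (if i \<in> S then a i else 0) + (if i = k then s else 0)) \<omega>"
proof -
  have "(\<Sum>i\<in>S. a i * X i \<omega>) = (\<Sum>i\<in>insert k S. (if i \<in> S then a i else 0) * X i \<omega>)"
    using assms by (intro sum.mono_neutral_cong_left) auto
  moreover have "s * X k \<omega> = (\<Sum>i\<in>insert k S. (if i = k then s else 0) * X i \<omega>)"
    using assms by (subst sum.cong[OF refl, of _ _ "\<lambda>i. if i = k then s * X k \<omega> else 0"]) (auto simp: sum.delta)
  ultimately show ?thesis by (simp add: linear_comb_def distrib_right sum.distrib)
qed

text \<open>A multivariate uniqueness theorem obtained from the one-dimensional one: coordinates are converted one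
  at a time from exponentials to indicators, the remaining exponential and the indicators found so far
  being part of the weight. Keeping the weights \<open>g1\<close> and \<open>g2\<close> general allows one to express both equality of
  laws (\<open>g1 = g2 = 1\<close>) and independence of an event or a variable from the family.\<close>
lemma cylinder_law_determined:
  fixes g1 :: "'a \<Rightarrow> complex" and g2 :: "'b \<Rightarrow> complex"
  assumes "prob_space M1" "prob_space M2"
    and meas [measurable]: "\<And>i. i \<in> I \<Longrightarrow> X1 i \<in> borel_measurable M1" "\<And>i. i \<in> I \<Longrightarrow> X2 i \<in> borel_measurable M2"
      "g1 \<in> borel_measurable M1" "g2 \<in> borel_measurable M2"
    and bd: "\<And>\<omega>. norm (g1 \<omega>) \<le> 1" "\<And>\<omega>. norm (g2 \<omega>) \<le> 1"
    and unw: "\<And>S a. finite S \<Longrightarrow> S \<subseteq> I \<Longrightarrow>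
      (\<integral>\<omega>. iexp (linear_comb X1 S a \<omega>) \<partial>M1) = (\<integral>\<omega>. iexp (linear_comb X2 S a \<omega>) \<partial>M2)"
    and eq: "\<And>S a. finite S \<Longrightarrow> S \<subseteq> I \<Longrightarrow>
      (\<integral>\<omega>. g1 \<omega> * iexp (linear_comb X1 S a \<omega>) \<partial>M1) = (\<integral>\<omega>. g2 \<omega> * iexp (linear_comb X2 S a \<omega>) \<partial>M2)"
    and J: "finite J" "J \<subseteq> I" "\<And>j. j \<in> J \<Longrightarrow> B j \<in> sets borel"
  shows "(\<integral>\<omega>. g1 \<omega> * (\<Prod>j\<in>J. indicator (B j) (X1 j \<omega>)) \<partial>M1) = (\<integral>\<omega>. g2 \<omega> * (\<Prod>j\<in>J. indicator (B j) (X2 j \<omega>)) \<partial>M2)"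
proof -
  have "(\<integral>\<omega>. g1 \<omega> * (\<Prod>j\<in>J. indicator (B j) (X1 j \<omega>)) * iexp (linear_comb X1 S a \<omega>) \<partial>M1) =
      (\<integral>\<omega>. g2 \<omega> * (\<Prod>j\<in>J. indicator (B j) (X2 j \<omega>)) * iexp (linear_comb X2 S a \<omega>) \<partial>M2)"
    if "finite S" "S \<subseteq> I" for S a
    using J that
  proof (induction J arbitrary: S a rule: finite_induct)
    case empty
    thus ?case using eq by simp
  next
    case (insert k J)
    have prod_meas [measurable]: "(\<lambda>\<omega>. (\<Prod>j\<in>J. indicator (B j) (X1 j \<omega>)) :: complex) \<in> borel_measurable M1"
      "(\<lambda>\<omega>. (\<Prod>j\<in>J. indicator (B j) (X2 j \<omega>)) :: complex) \<in> borel_measurable M2"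
      using insert.prems meas(1,2)
      by (auto intro!: borel_measurable_prod borel_measurable_indicator' measurable_compose[OF meas(1)] measurable_compose[OF meas(2)])
    have [measurable]: "linear_comb X1 S a \<in> borel_measurable M1" "linear_comb X2 S a \<in> borel_measurable M2"
      using insert.prems meas(1,2) by (auto intro!: measurable_linear_comb)
    have [measurable]: "X1 k \<in> borel_measurable M1" "X2 k \<in> borel_measurable M2" "B k \<in> sets borel"
      using insert.prems by auto
    have pb: "norm (\<Prod>j\<in>J. indicator (B j) (f j) :: complex) \<le> 1" for f
      unfolding prod_norm[symmetric] by (intro prod_le_1) (auto simp: indicator_def)
    have "(\<integral>\<omega>. (g1 \<omega> * (\<Prod>j\<in>J. indicator (B j) (X1 j \<omega>)) * iexp (linear_comb X1 S a \<omega>)) * indicator (B k) (X1 k \<omega>) \<partial>M1) =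
      (\<integral>\<omega>. (g2 \<omega> * (\<Prod>j\<in>J. indicator (B j) (X2 j \<omega>)) * iexp (linear_comb X2 S a \<omega>)) * indicator (B k) (X2 k \<omega>) \<partial>M2)"
    proof (rule bounded_weight_law_determined)
      show "norm (g1 \<omega> * (\<Prod>j\<in>J. indicator (B j) (X1 j \<omega>)) * iexp (linear_comb X1 S a \<omega>)) \<le> 1" for \<omega>
        using bd(1)[of \<omega>] pb by (simp add: norm_mult mult_le_one)
      show "norm (g2 \<omega> * (\<Prod>j\<in>J. indicator (B j) (X2 j \<omega>)) * iexp (linear_comb X2 S a \<omega>)) \<le> 1" for \<omega>
        using bd(2)[of \<omega>] pb by (simp add: norm_mult mult_le_one)
      show "(\<integral>\<omega>. iexp (s * X1 k \<omega>) \<partial>M1) = (\<integral>\<omega>. iexp (s * X2 k \<omega>) \<partial>M2)" for s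
        using unw[of "{k}" "\<lambda>_. s"] insert.prems by (simp add: linear_comb_def)
      have ii: "iexp x * iexp y = iexp (x + y)" for x y by (simp add: exp_add distrib_left)
      show "(\<integral>\<omega>. (g1 \<omega> * (\<Prod>j\<in>J. indicator (B j) (X1 j \<omega>)) * iexp (linear_comb X1 S a \<omega>)) * iexp (s * X1 k \<omega>) \<partial>M1) =
        (\<integral>\<omega>. (g2 \<omega> * (\<Prod>j\<in>J. indicator (B j) (X2 j \<omega>)) * iexp (linear_comb X2 S a \<omega>)) * iexp (s * X2 k \<omega>) \<partial>M2)" for s
        unfolding mult.assoc[of _ "iexp _"] ii linear_comb_insert[OF insert.prems(3)]
        using insert.prems by (intro insert.IH) auto
    qed (use assms(1,2) in measurable)
    moreover have prod_insert: "g * (\<Prod>j\<in>insert k J. indicator (B j) (f j)) * e =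
      g * (\<Prod>j\<in>J. indicator (B j) (f j)) * e * indicator (B k) (f k)" for g e :: complex and f
      using insert.hyps by (simp add: mult_ac)
    ultimately show ?case by (simp only: prod_insert)
  qed
  from this[of "{}"] show ?thesis by (simp add: linear_comb_def)
qed

section \<open>The Gaussian field\<close>
lemma (in prob_space) gaussian_rv_moments:
  assumes X: "gaussian_rv M X"
  shows "integrable M X" "integrable M (\<lambda>\<omega>. (X \<omega>)\<^sup>2)"
proof -
  have [measurable]: "X \<in> borel_measurable M" using X by (simp add: gaussian_rv_def)
  from X consider \<mu> \<sigma> where "\<sigma> > 0" "distributed M lborel X (normal_density \<mu> \<sigma>)"
    | c where "AE \<omega> in M. X \<omega> = c" unfolding gaussian_rv_def by blast
  hence "integrable M X \<and> integrable M (\<lambda>\<omega>. (X \<omega>)\<^sup>2)"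
  proof cases
    case 1
    have "integrable lborel (\<lambda>x. normal_density \<mu> \<sigma> x * (x - \<mu>) ^ 1)"
      "integrable lborel (\<lambda>x. normal_density \<mu> \<sigma> x * (x - \<mu>) ^ 2)"
      using 1 by (intro integrable_normal_moment; simp)+
    hence c: "integrable M (\<lambda>\<omega>. X \<omega> - \<mu>)" "integrable M (\<lambda>\<omega>. (X \<omega> - \<mu>)\<^sup>2)"
      using distributed_integrable[OF 1(2), of "\<lambda>x. x - \<mu>"] distributed_integrable[OF 1(2), of "\<lambda>x. (x - \<mu>)\<^sup>2"] by auto
    note i = Bochner_Integration.integrable_add[OF c(1) integrable_const[of \<mu>]]
      Bochner_Integration.integrable_add[OF Bochner_Integration.integrable_add[OF c(2)
        integrable_mult_right[OF c(1), of "2 * \<mu>"]] integrable_const[of "\<mu>\<^sup>2"]]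
    have "(X \<omega> - \<mu>)\<^sup>2 + 2 * \<mu> * (X \<omega> - \<mu>) + \<mu>\<^sup>2 = (X \<omega>)\<^sup>2" for \<omega>
      by (simp add: power2_eq_square algebra_simps)
    thus ?thesis using i by simp
  next
    case 2
    have "integrable M (\<lambda>_. c)" "integrable M (\<lambda>_. c\<^sup>2)" by auto
    moreover have "AE \<omega> in M. (X \<omega>)\<^sup>2 = c\<^sup>2" using 2 by auto
    ultimately show ?thesis using 2
      by (auto intro: integrable_cong_AE_imp)
  qed
  thus "integrable M X" "integrable M (\<lambda>\<omega>. (X \<omega>)\<^sup>2)" by auto
qed

lemma (in prob_space) gaussian_rv_char:
  assumes X: "gaussian_rv M X" and mean: "expectation X = 0"
  shows "(\<integral>\<omega>. iexp (X \<omega>) \<partial>M) = exp (- expectation (\<lambda>\<omega>. (X \<omega>)\<^sup>2) / 2)"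
proof -
  have [measurable]: "X \<in> borel_measurable M" using X by (simp add: gaussian_rv_def)
  from X consider \<mu> \<sigma> where "\<sigma> > 0" "distributed M lborel X (normal_density \<mu> \<sigma>)"
    | c where "AE \<omega> in M. X \<omega> = c" unfolding gaussian_rv_def by blast
  thus ?thesis
  proof cases
    case 1
    have \<mu>: "\<mu> = 0" using normal_distributed_expectation[OF 1] mean by simp
    have v: "expectation (\<lambda>\<omega>. (X \<omega>)\<^sup>2) = \<sigma>\<^sup>2" using normal_distributed_variance[OF 1] mean by simp
    have D: "distributed M lborel (\<lambda>\<omega>. X \<omega> / \<sigma>) std_normal_density"
      using normal_standard_normal_convert[OF 1(1), of X \<mu>] 1(2) \<mu> by simp
    have "(\<integral>\<omega>. iexp (X \<omega>) \<partial>M) = (\<integral>\<omega>. iexp (\<sigma> * (X \<omega> / \<sigma>)) \<partial>M)"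
      using 1 by simp
    also have "\<dots> = (\<integral>x. iexp (\<sigma> * x) \<partial>distr M lborel (\<lambda>\<omega>. X \<omega> / \<sigma>))"
      by (subst integral_distr) auto
    also have "\<dots> = char std_normal_distribution \<sigma>"
      unfolding char_def distributed_distr_eq_density[OF D] by simp
    finally show ?thesis by (simp add: char_std_normal_distribution v exp_of_real)
  next
    case 2
    have "expectation X = expectation (\<lambda>_. c)" using 2 by (intro integral_cong_AE) auto
    hence "c = 0" using mean by (simp add: prob_space)
    have "expectation (\<lambda>\<omega>. (X \<omega>)\<^sup>2) = expectation (\<lambda>_. 0)"
      using 2 \<open>c = 0\<close> by (intro integral_cong_AE) auto
    moreover have "(\<integral>\<omega>. iexp (X \<omega>) \<partial>M) = (\<integral>\<omega>. 1 \<partial>M)"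
      using 2 \<open>c = 0\<close> by (intro integral_cong_AE) auto
    ultimately show ?thesis by (simp add: prob_space)
  qed
qed

text \<open>The Chernoff bound with exponent \<open>t = l / v\<close>, which is optimal for variance \<open>v\<close>.\<close>
lemma (in prob_space) gaussian_rv_tail:
  assumes X: "gaussian_rv M X" and mean: "expectation X = 0"
    and v: "expectation (\<lambda>\<omega>. (X \<omega>)\<^sup>2) \<le> v" "v > 0" and l: "l > 0"
  shows "prob {\<omega> \<in> space M. X \<omega> \<ge> l} \<le> exp (- l\<^sup>2 / (2 * v))"
proof -
  have [measurable]: "X \<in> borel_measurable M" using X by (simp add: gaussian_rv_def)
  from X consider \<mu> \<sigma> where "\<sigma> > 0" "distributed M lborel X (normal_density \<mu> \<sigma>)"
    | c where "AE \<omega> in M. X \<omega> = c" unfolding gaussian_rv_def by blast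
  thus ?thesis
  proof cases
    case 1
    have \<mu>: "\<mu> = 0" using normal_distributed_expectation[OF 1] mean by simp
    have v': "\<sigma>\<^sup>2 \<le> v" using normal_distributed_variance[OF 1] mean v by simp
    define t where "t = l / v"
    have t: "t > 0" using l v by (simp add: t_def)
    \<comment> \<open>Completing the square: exponential tilting shifts the mean of a normal density.\<close>
    have dens: "normal_density \<mu> \<sigma> x * exp (t * x) = exp (t\<^sup>2 * \<sigma>\<^sup>2 / 2) * normal_density (t * \<sigma>\<^sup>2) \<sigma> x" for x
    proof -
      have "- x\<^sup>2 / (2 * \<sigma>\<^sup>2) + t * x = t\<^sup>2 * \<sigma>\<^sup>2 / 2 + (- (x - t * \<sigma>\<^sup>2)\<^sup>2 / (2 * \<sigma>\<^sup>2))"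
        using 1 by (simp add: field_simps power2_eq_square)
      hence "exp (- x\<^sup>2 / (2 * \<sigma>\<^sup>2)) * exp (t * x) = exp (t\<^sup>2 * \<sigma>\<^sup>2 / 2) * exp (- (x - t * \<sigma>\<^sup>2)\<^sup>2 / (2 * \<sigma>\<^sup>2))"
        by (simp only: exp_add[symmetric])
      thus ?thesis using \<mu> by (simp add: normal_density_def)
    qed
    have i: "integrable M (\<lambda>\<omega>. exp (t * X \<omega>))"
      using distributed_integrable[OF 1(2), of "\<lambda>x. exp (t * x)"] 1 by (simp add: dens)
    have "expectation (\<lambda>\<omega>. exp (t * X \<omega>)) = exp (t\<^sup>2 * \<sigma>\<^sup>2 / 2)"
      using distributed_integral[OF 1(2), of "\<lambda>x. exp (t * x)"] 1 by (simp add: dens)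
    also have "\<dots> \<le> exp (t\<^sup>2 * v / 2)" using v' by (simp add: mult_left_mono)
    finally have e: "expectation (\<lambda>\<omega>. exp (t * X \<omega>)) \<le> exp (t\<^sup>2 * v / 2)" .
    have "prob {\<omega> \<in> space M. X \<omega> \<ge> l} = prob {\<omega> \<in> space M. exp (t * X \<omega>) \<ge> exp (t * l)}"
      using t by simp
    also have "\<dots> \<le> expectation (\<lambda>\<omega>. exp (t * X \<omega>)) / exp (t * l)"
      by (rule integral_Markov_inequality_measure[OF i, of "{}"]) auto
    also have "\<dots> \<le> exp (t\<^sup>2 * v / 2) / exp (t * l)" using e by (intro divide_right_mono) auto
    also have "\<dots> = exp (t\<^sup>2 * v / 2 - t * l)" by (simp add: exp_diff)
    also have "t\<^sup>2 * v / 2 - t * l = - l\<^sup>2 / (2 * v)"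
      using v by (simp add: t_def field_simps power2_eq_square)
    finally show ?thesis .
  next
    case 2
    have "expectation X = expectation (\<lambda>_. c)" using 2 by (intro integral_cong_AE) auto
    hence "c = 0" using mean by (simp add: prob_space)
    hence "AE \<omega> in M. \<not> X \<omega> \<ge> l" using 2 l by auto
    hence "prob {\<omega> \<in> space M. X \<omega> \<ge> l} = 0" by (subst prob_eq_0) auto
    thus ?thesis by simp
  qed
qed

locale gff = prob_space P for P :: "(int ^ 'd \<Rightarrow> real) measure" +
  assumes dim: "CARD('d) \<ge> 3" and law: "gff_law P"
begin

lemma sets_P: "sets P = sets (Pi\<^sub>M UNIV (\<lambda>_. borel))"
  using law by (simp add: gff_law_def)

lemma space_P [simp]: "space P = UNIV"
  using sets_eq_imp_space_eq[OF sets_P] by (simp add: space_PiM)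

lemma coord_measurable [measurable]: "(\<lambda>\<phi>. \<phi> x) \<in> borel_measurable P"
  by (subst measurable_cong_sets[OF sets_P refl]) measurable

lemma measurable_P_iff: "f \<in> measurable M P \<longleftrightarrow> (\<forall>x. (\<lambda>\<omega>. f \<omega> x) \<in> borel_measurable M)"
proof -
  have "f \<in> measurable M P \<longleftrightarrow> f \<in> measurable M (Pi\<^sub>M UNIV (\<lambda>_. borel))"
    by (rule arg_cong[where f = "\<lambda>A. f \<in> A"], rule measurable_cong_sets[OF refl sets_P])
  also have "\<dots> \<longleftrightarrow> (\<forall>x. (\<lambda>\<omega>. f \<omega> x) \<in> borel_measurable M)"
    by (auto intro!: measurable_PiM_single' simp: measurable_component_singleton[THEN measurable_compose_rev])
  finally show ?thesis .
qed

definition is_comb :: "((int ^ 'd \<Rightarrow> real) \<Rightarrow> real) \<Rightarrow> bool" where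
  "is_comb W \<longleftrightarrow> (\<exists>S a. finite S \<and> W = linear_comb (\<lambda>x \<phi>. \<phi> x) S a)"

lemma is_comb_0: "is_comb (\<lambda>_. 0)"
  unfolding is_comb_def by (rule exI[of _ "{}"]) (auto simp: fun_eq_iff linear_comb_def)

lemma is_comb_add_coord:
  assumes "is_comb W"
  shows "is_comb (\<lambda>\<phi>. W \<phi> + s * \<phi> x)"
proof -
  obtain S a where "finite S" "W = linear_comb (\<lambda>x \<phi>. \<phi> x) S a" using assms by (auto simp: is_comb_def)
  thus ?thesis unfolding is_comb_def
    using linear_comb_insert[of S "\<lambda>x \<phi>. \<phi> x" a _ s x]
    by (intro exI[of _ "insert x S"]) (auto simp: fun_eq_iff)
qed

lemma is_comb_add:
  assumes "is_comb W" "is_comb V"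
  shows "is_comb (\<lambda>\<phi>. W \<phi> + V \<phi>)"
proof -
  obtain S a where S: "finite S" "V = linear_comb (\<lambda>x \<phi>. \<phi> x) S a" using assms by (auto simp: is_comb_def)
  have "is_comb (\<lambda>\<phi>. W \<phi> + (\<Sum>x\<in>S. a x * \<phi> x))"
    using S(1)
  proof (induction S rule: finite_induct)
    case (insert x S)
    thus ?case using is_comb_add_coord[OF insert.IH, of "a x" x] by (simp add: add_ac)
  qed (use assms in simp)
  thus ?thesis by (simp add: S(2) linear_comb_def)
qed

lemma is_comb_coord: "is_comb (\<lambda>\<phi>. \<phi> x)"
  using is_comb_add_coord[OF is_comb_0, of 1 x] by simp

lemma is_comb_scale:
  assumes "is_comb W"
  shows "is_comb (\<lambda>\<phi>. c * W \<phi>)"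
proof -
  obtain S a where "finite S" "W = linear_comb (\<lambda>x \<phi>. \<phi> x) S a" using assms by (auto simp: is_comb_def)
  thus ?thesis unfolding is_comb_def
    by (intro exI[of _ S] exI[of _ "\<lambda>x. c * a x"]) (auto simp: fun_eq_iff linear_comb_def sum_distrib_left mult_ac)
qed

lemma is_comb_sum:
  assumes "finite S" "\<And>i. i \<in> S \<Longrightarrow> is_comb (W i)"
  shows "is_comb (\<lambda>\<phi>. \<Sum>i\<in>S. W i \<phi>)"
  using assms by (induction S rule: finite_induct) (auto intro: is_comb_0 is_comb_add)

lemma is_comb_linear_comb:
  assumes "finite S" "\<And>i. i \<in> S \<Longrightarrow> is_comb (X i)"
  shows "is_comb (linear_comb X S a)"
  unfolding linear_comb_def[abs_def] using assms by (intro is_comb_sum is_comb_scale) auto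

lemma is_comb_gaussian:
  assumes "is_comb W"
  shows "gaussian_rv P W" "expectation W = 0"
proof -
  obtain S a where S: "finite S" "W = linear_comb (\<lambda>x \<phi>. \<phi> x) S a" using assms by (auto simp: is_comb_def)
  have F: "centered_gaussian_field P (\<lambda>x \<phi>. \<phi> x)" using law by (simp add: gff_law_def)
  have G: "gaussian_rv P (\<lambda>\<phi>. \<Sum>x\<in>S. a x * \<phi> x)" if "finite S" for S a
    using F that unfolding centered_gaussian_field_def by blast
  show "gaussian_rv P W" using G[OF S(1), of a] by (simp add: S(2) linear_comb_def[abs_def])
  have i: "integrable P (\<lambda>\<phi>. \<phi> x)" for x
    using gaussian_rv_moments(1)[OF G[of "{x}" "\<lambda>_. 1"]] by simp
  have "expectation (\<lambda>\<phi>. \<phi> x) = 0" for x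
    using F by (simp add: centered_gaussian_field_def)
  thus "expectation W = 0" using i by (simp add: S(2) linear_comb_def[abs_def])
qed

lemma is_comb_measurable: "is_comb W \<Longrightarrow> W \<in> borel_measurable P"
  using is_comb_gaussian(1) by (auto simp: gaussian_rv_def)

lemma is_comb_integrable: "is_comb W \<Longrightarrow> integrable P W"
  using gaussian_rv_moments(1)[OF is_comb_gaussian(1)] .

lemma is_comb_integrable_mult:
  assumes "is_comb W" "is_comb V"
  shows "integrable P (\<lambda>\<phi>. W \<phi> * V \<phi>)"
proof -
  note sq = gaussian_rv_moments(2)[OF is_comb_gaussian(1)]
  have "integrable P (\<lambda>\<phi>. ((W \<phi> + V \<phi>)\<^sup>2 - (W \<phi>)\<^sup>2 - (V \<phi>)\<^sup>2) / 2)"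
    using sq[OF assms(1)] sq[OF assms(2)] sq[OF is_comb_add[OF assms]] by auto
  moreover have "((W \<phi> + V \<phi>)\<^sup>2 - (W \<phi>)\<^sup>2 - (V \<phi>)\<^sup>2) / 2 = W \<phi> * V \<phi>" for \<phi>
    by (simp add: power2_sum)
  ultimately show ?thesis by simp
qed

lemma is_comb_char:
  assumes "is_comb W"
  shows "(\<integral>\<phi>. iexp (W \<phi>) \<partial>P) = exp (- expectation (\<lambda>\<phi>. W \<phi> * W \<phi>) / 2)"
  using gaussian_rv_char[OF is_comb_gaussian[OF assms]] by (simp add: power2_eq_square)

lemma covariance: "expectation (\<lambda>\<phi>. \<phi> x * \<phi> y) = green x y"
  using law by (simp add: gff_law_def)

lemma green_commute: "green x y = green y (x :: int ^ 'd)"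
  by (simp only: covariance[symmetric] mult.commute)

lemma covariance_linear_comb:
  assumes "finite S" "finite T"
  shows "expectation (\<lambda>\<phi>. linear_comb (\<lambda>i \<phi>. \<phi> (f i)) S a \<phi> * linear_comb (\<lambda>i \<phi>. \<phi> (g i)) T b \<phi>) =
    (\<Sum>i\<in>S. \<Sum>j\<in>T. a i * b j * green (f i) (g j))"
proof -
  have i: "integrable P (\<lambda>\<phi>. \<phi> x * \<phi> y)" for x y
    by (intro is_comb_integrable_mult is_comb_coord)
  have "expectation (\<lambda>\<phi>. linear_comb (\<lambda>i \<phi>. \<phi> (f i)) S a \<phi> * linear_comb (\<lambda>i \<phi>. \<phi> (g i)) T b \<phi>) =
    expectation (\<lambda>\<phi>. \<Sum>i\<in>S. \<Sum>j\<in>T. a i * b j * (\<phi> (f i) * \<phi> (g j)))"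
    by (rule arg_cong[where f = "integral\<^sup>L P"]) (simp add: fun_eq_iff linear_comb_def sum_product mult_ac)
  also have "\<dots> = (\<Sum>i\<in>S. \<Sum>j\<in>T. a i * b j * green (f i) (g j))"
    using i by (simp add: Bochner_Integration.integral_sum covariance)
  finally show ?thesis .
qed

definition translate :: "int ^ 'd \<Rightarrow> (int ^ 'd \<Rightarrow> real) \<Rightarrow> int ^ 'd \<Rightarrow> real" where
  "translate v \<phi> = (\<lambda>x. \<phi> (x + v))"

lemma translate_measurable [measurable]: "translate v \<in> measurable P P"
  by (subst measurable_P_iff) (simp add: translate_def)

lemma char_shift:
  assumes "finite S"
  shows "(\<integral>\<phi>. iexp (linear_comb (\<lambda>i \<phi>. \<phi> (i + v)) S a \<phi>) \<partial>P) =
         (\<integral>\<phi>. iexp (linear_comb (\<lambda>i \<phi>. \<phi> i) S a \<phi>) \<partial>P)"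
proof -
  have "is_comb (linear_comb (\<lambda>i \<phi>. \<phi> (i + v)) S a)" for v
    using assms by (intro is_comb_linear_comb is_comb_coord) auto
  from is_comb_char[OF this[of v]] is_comb_char[OF this[of 0]] show ?thesis
    using assms covariance_linear_comb[where f="\<lambda>i. i" and g="\<lambda>i. i"]
    by (simp add: covariance_linear_comb green_shift)
qed

lemma eq_P_if_cylinders:
  assumes Q: "prob_space Q" "sets Q = sets P"
    and eq: "\<And>J B. finite J \<Longrightarrow> (\<And>j. j \<in> J \<Longrightarrow> B j \<in> sets borel) \<Longrightarrow>
      measure Q {\<phi>. \<forall>j\<in>J. \<phi> j \<in> B j} = prob {\<phi>. \<forall>j\<in>J. \<phi> j \<in> B j}"
  shows "Q = P"
proof (rule measure_eqI_PiM_infinite[symmetric])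
  interpret Q: prob_space Q by fact
  fix B :: "int ^ 'd \<Rightarrow> real set" and J assume J: "finite J" "\<And>i. i \<in> J \<Longrightarrow> B i \<in> sets borel"
  have "prod_emb UNIV (\<lambda>_. borel) J (Pi\<^sub>E J B) = {\<phi>. \<forall>j\<in>J. \<phi> j \<in> B j}"
    by (auto simp: prod_emb_def PiE_iff extensional_def)
  thus "emeasure P (prod_emb UNIV (\<lambda>_. borel) J (Pi\<^sub>E J B)) = emeasure Q (prod_emb UNIV (\<lambda>_. borel) J (Pi\<^sub>E J B))"
    using eq[OF J] by (simp add: emeasure_eq_measure Q.emeasure_eq_measure)
qed (use Q sets_P in \<open>auto intro: finite_measure_axioms\<close>)

lemma cylinder_sets [measurable]:
  assumes "finite J" "\<And>j. j \<in> J \<Longrightarrow> B j \<in> sets borel"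
  shows "{\<phi>. \<forall>j\<in>J. \<phi> j \<in> B j} \<in> sets P"
proof -
  have "{\<phi> \<in> space P. \<forall>j\<in>J. \<phi> j \<in> B j} \<in> sets P"
    using assms by (intro sets.sets_Collect_finite_All measurable_sets_Collect[OF coord_measurable]) auto
  thus ?thesis by simp
qed

lemma prod_indicator_cylinder:
  "finite J \<Longrightarrow> (\<Prod>j\<in>J. indicator (B j) (f j)) = (indicator {\<phi>. \<forall>j\<in>J. \<phi> j \<in> B j} f :: 'b :: comm_semiring_1)"
  by (induction J rule: finite_induct) (auto simp: indicator_def)

lemma integral_complex_indicator:
  assumes "A \<in> events"
  shows "(\<integral>\<phi>. indicator A \<phi> \<partial>P) = complex_of_real (prob A)"
proof -
  have "(\<integral>\<phi>. indicator A \<phi> \<partial>P) = (\<integral>\<phi>. complex_of_real (indicator A \<phi>) \<partial>P)"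
    by (intro Bochner_Integration.integral_cong) (auto simp: indicator_def)
  thus ?thesis using assms by simp
qed

text \<open>The two laws have the same characteristic functions because the Green function is translation invariant.\<close>
lemma translation_invariant: "distr P P (translate v) = P"
proof (rule eq_P_if_cylinders)
  show "prob_space (distr P P (translate v))" by (rule prob_space_distr) measurable
  fix J and B :: "int ^ 'd \<Rightarrow> real set" assume J: "finite J" "\<And>j. j \<in> J \<Longrightarrow> B j \<in> sets borel"
  note [measurable] = cylinder_sets[OF J]
  have "(\<integral>\<phi>. 1 * (\<Prod>j\<in>J. indicator (B j) (\<phi> (j + v))) \<partial>P) = (\<integral>\<phi>. 1 * (\<Prod>j\<in>J. indicator (B j) (\<phi> j)) \<partial>P :: complex)"
    by (rule cylinder_law_determined[where I = UNIV]) (use J char_shift prob_space_axioms in auto)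
  moreover have "(\<Prod>j\<in>J. indicator (B j) (\<phi> (j + v))) = (indicator (translate v -` {\<phi>. \<forall>j\<in>J. \<phi> j \<in> B j}) \<phi> :: complex)" for \<phi>
    using prod_indicator_cylinder[OF J(1), of B "translate v \<phi>"] by (simp add: translate_def indicator_def)
  moreover have meas: "translate v -` {\<phi>. \<forall>j\<in>J. \<phi> j \<in> B j} \<in> sets P"
    using measurable_sets[OF translate_measurable[of v] cylinder_sets[OF J]] by simp
  ultimately have "complex_of_real (prob (translate v -` {\<phi>. \<forall>j\<in>J. \<phi> j \<in> B j})) = prob {\<phi>. \<forall>j\<in>J. \<phi> j \<in> B j}"
    using J by (simp add: prod_indicator_cylinder integral_complex_indicator del: vimage_Collect_eq)
  thus "measure (distr P P (translate v)) {\<phi>. \<forall>j\<in>J. \<phi> j \<in> B j} = prob {\<phi>. \<forall>j\<in>J. \<phi> j \<in> B j}"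
    by (simp add: measure_distr del: vimage_Collect_eq)
qed simp

text \<open>Under Gaussianity \<open>Y\<close> is independent of the values of the field on \<open>J\<close>. Only the symmetry of the joint law
  under \<open>Y \<mapsto> - Y\<close> is exploited: it makes \<open>sin (t * Y)\<close> orthogonal to all exponentials of the field on \<open>J\<close>, hence
  to the cylinder, and \<open>sin (t * Y) / t\<close> converges to \<open>Y\<close> as \<open>t\<close> tends to \<open>0\<close>. The detour over the sine is due
  to the boundedness of weights in \<open>cylinder_law_determined\<close>.\<close>
lemma uncorrelated_mean_zero:
  assumes Y: "is_comb Y" and orth: "\<And>z. z \<in> J \<Longrightarrow> expectation (\<lambda>\<phi>. Y \<phi> * \<phi> z) = 0"
    and J: "finite J" "\<And>j. j \<in> J \<Longrightarrow> B j \<in> sets borel"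
  shows "expectation (\<lambda>\<phi>. Y \<phi> * indicator {\<phi>. \<forall>j\<in>J. \<phi> j \<in> B j} \<phi>) = 0"
proof -
  note [measurable] = cylinder_sets[OF J] is_comb_measurable[OF Y]
  let ?C = "{\<phi>. \<forall>j\<in>J. \<phi> j \<in> B j}"
  have char0: "(\<integral>\<phi>. complex_of_real (sin (t * Y \<phi>)) * iexp (linear_comb (\<lambda>x \<phi>. \<phi> x) S a \<phi>) \<partial>P) = 0"
    if S: "finite S" "S \<subseteq> J" for S a t
  proof -
    define W where "W = linear_comb (\<lambda>x (\<phi> :: int ^ 'd \<Rightarrow> real). \<phi> x) S a"
    have W: "is_comb W" unfolding W_def using S by (intro is_comb_linear_comb is_comb_coord) auto
    note [measurable] = is_comb_measurable[OF W]
    have iYz: "integrable P (\<lambda>\<phi>. Y \<phi> * \<phi> z)" for z by (intro is_comb_integrable_mult Y is_comb_coord)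
    have "expectation (\<lambda>\<phi>. Y \<phi> * W \<phi>) = expectation (\<lambda>\<phi>. \<Sum>z\<in>S. a z * (Y \<phi> * \<phi> z))"
      by (rule arg_cong[where f = "integral\<^sup>L P"]) (simp add: fun_eq_iff W_def linear_comb_def sum_distrib_left mult_ac)
    also have "\<dots> = 0" using iYz S orth by (auto simp: Bochner_Integration.integral_sum intro!: sum.neutral)
    finally have YW: "expectation (\<lambda>\<phi>. Y \<phi> * W \<phi>) = 0" .
    have E: "(\<integral>\<phi>. iexp (s * Y \<phi> + W \<phi>) \<partial>P) =
      exp (- (s\<^sup>2 * expectation (\<lambda>\<phi>. Y \<phi> * Y \<phi>) + expectation (\<lambda>\<phi>. W \<phi> * W \<phi>)) / 2)" for s
    proof -
      have "expectation (\<lambda>\<phi>. (s * Y \<phi> + W \<phi>) * (s * Y \<phi> + W \<phi>)) =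
         expectation (\<lambda>\<phi>. s\<^sup>2 * (Y \<phi> * Y \<phi>) + (2 * s) * (Y \<phi> * W \<phi>) + W \<phi> * W \<phi>)"
        by (rule arg_cong[where f = "integral\<^sup>L P"]) (simp add: fun_eq_iff algebra_simps power2_eq_square)
      also have "\<dots> = s\<^sup>2 * expectation (\<lambda>\<phi>. Y \<phi> * Y \<phi>) + expectation (\<lambda>\<phi>. W \<phi> * W \<phi>)"
        using is_comb_integrable_mult Y W YW by simp
      finally show ?thesis
        using is_comb_char[OF is_comb_add[OF is_comb_scale[OF Y, of s] W]] by simp
    qed
    have i: "integrable P (\<lambda>\<phi>. iexp (s * Y \<phi> + W \<phi>))" for s
      by (rule integrable_bounded_by_1) auto
    have "complex_of_real (sin (t * Y \<phi>)) * iexp (W \<phi>) =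
      (iexp (t * Y \<phi> + W \<phi>) - iexp ((- t) * Y \<phi> + W \<phi>)) / (2 * \<i>)" for \<phi>
    proof -
      have "complex_of_real (sin (t * Y \<phi>)) = (iexp (t * Y \<phi>) - exp (- (\<i> * complex_of_real (t * Y \<phi>)))) / (2 * \<i>)"
        by (simp only: sin_of_real[symmetric] sin_exp_eq)
      moreover have "iexp (t * Y \<phi> + W \<phi>) = iexp (t * Y \<phi>) * iexp (W \<phi>)"
        "iexp ((- t) * Y \<phi> + W \<phi>) = exp (- (\<i> * complex_of_real (t * Y \<phi>))) * iexp (W \<phi>)"
        by (simp_all add: exp_add[symmetric] algebra_simps)
      ultimately show ?thesis by (simp only: times_divide_eq_left left_diff_distrib)
    qed
    hence "(\<integral>\<phi>. complex_of_real (sin (t * Y \<phi>)) * iexp (W \<phi>) \<partial>P) =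
      ((\<integral>\<phi>. iexp (t * Y \<phi> + W \<phi>) \<partial>P) - (\<integral>\<phi>. iexp ((- t) * Y \<phi> + W \<phi>) \<partial>P)) / (2 * \<i>)"
      using i[of t] i[of "- t"] by (simp only: integral_divide_zero Bochner_Integration.integral_diff)
    also have "\<dots> = 0" unfolding E by simp
    finally show ?thesis by (simp add: W_def)
  qed
  have sin0: "expectation (\<lambda>\<phi>. sin (t * Y \<phi>) * indicator ?C \<phi>) = 0" for t
  proof -
    have "(\<integral>\<phi>. complex_of_real (sin (t * Y \<phi>)) * (\<Prod>j\<in>J. indicator (B j) (\<phi> j)) \<partial>P) =
       (\<integral>\<phi>. 0 * (\<Prod>j\<in>J. indicator (B j) (\<phi> j)) \<partial>P)"
      by (rule cylinder_law_determined[where I = J]) (use J char0 prob_space_axioms in auto)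
    hence "(\<integral>\<phi>. complex_of_real (sin (t * Y \<phi>)) * indicator ?C \<phi> \<partial>P) = 0"
      by (simp add: prod_indicator_cylinder J)
    also have "(\<lambda>\<phi>. complex_of_real (sin (t * Y \<phi>)) * indicator ?C \<phi>) =
      (\<lambda>\<phi>. complex_of_real (sin (t * Y \<phi>) * indicator ?C \<phi>))"
      by (auto simp: indicator_def)
    finally show ?thesis by (simp del: of_real_mult)
  qed
  define t where "t n = 1 / real (Suc n)" for n
  have "(\<lambda>n. expectation (\<lambda>\<phi>. sin (t n * Y \<phi>) / t n * indicator ?C \<phi>)) \<longlonglongrightarrow>
    expectation (\<lambda>\<phi>. Y \<phi> * indicator ?C \<phi>)"
  proof (rule integral_dominated_convergence[where w = "\<lambda>\<phi>. \<bar>Y \<phi>\<bar>"])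
    have "filterlim t (at 0) sequentially"
      unfolding t_def filterlim_at using LIMSEQ_inverse_real_of_nat by (simp add: inverse_eq_divide)
    moreover have "((\<lambda>s. sin (s * y) / s) \<longlongrightarrow> y) (at 0)" for y :: real
    proof -
      have "((\<lambda>s. sin (s * y)) has_real_derivative y) (at 0)"
        by (auto intro!: derivative_eq_intros)
      thus ?thesis by (simp add: has_field_derivative_iff)
    qed
    ultimately have sin_lim: "(\<lambda>n. sin (t n * y) / t n) \<longlonglongrightarrow> y" for y
      using filterlim_compose by blast
    thus "AE \<phi> in P. (\<lambda>n. sin (t n * Y \<phi>) / t n * indicator ?C \<phi>) \<longlonglongrightarrow> Y \<phi> * indicator ?C \<phi>"
      by (intro AE_I2 tendsto_mult sin_lim tendsto_const)
    have "\<bar>sin (t n * y) / t n\<bar> \<le> \<bar>y\<bar>" for n y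
    proof -
      have "t n > 0" by (simp add: t_def)
      thus ?thesis using abs_sin_x_le_abs_x[of "t n * y"] by (simp add: abs_mult field_simps)
    qed
    thus "AE \<phi> in P. norm (sin (t n * Y \<phi>) / t n * indicator ?C \<phi>) \<le> \<bar>Y \<phi>\<bar>" for n
      by (auto simp: indicator_def)
  qed (use is_comb_integrable[OF Y] in auto)
  moreover have zero: "expectation (\<lambda>\<phi>. sin (t n * Y \<phi>) / t n * indicator ?C \<phi>) = 0" for n
    using sin0[of "t n"] by simp
  ultimately show ?thesis by (simp only: zero LIMSEQ_const_iff)
qed

end

section \<open>Clusters\<close>
lemma induced_edges_mono: "E \<subseteq> F \<Longrightarrow> induced_edges E \<subseteq> induced_edges F"
  by (auto simp: induced_edges_def)

lemma sym_induced_edges: "sym (induced_edges E)"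
  by (auto simp: sym_def induced_edges_def adjacent_sym)

lemma connected_in_refl: "x \<in> E \<Longrightarrow> (x, x) \<in> connected_in E"
  by (simp add: connected_in_def)

lemma connected_in_sym: "(x, y) \<in> connected_in E \<Longrightarrow> (y, x) \<in> connected_in E"
  using symD[OF sym_rtrancl[OF sym_induced_edges[of E]]] by (simp add: connected_in_def)

lemma connected_in_trans:
  "(x, y) \<in> connected_in E \<Longrightarrow> (y, z) \<in> connected_in E \<Longrightarrow> (x, z) \<in> connected_in E"
  by (auto simp: connected_in_def)

lemma connected_in_mono: "E \<subseteq> F \<Longrightarrow> connected_in E \<subseteq> connected_in F"
  unfolding connected_in_def using rtrancl_mono[OF induced_edges_mono] by blast

lemma in_infinite_cluster_iff:
  "(\<exists>C\<in>clusters E. x \<in> C \<and> infinite C) \<longleftrightarrow> infinite (connected_in E `` {x})"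
proof
  assume "\<exists>C\<in>clusters E. x \<in> C \<and> infinite C"
  then obtain C where C: "C \<in> E // connected_in E" "x \<in> C" "infinite C" by (auto simp: clusters_def)
  have "C = connected_in E `` {x}"
    using C(1,2) by (auto elim!: quotientE dest: connected_in_sym connected_in_trans)
  thus "infinite (connected_in E `` {x})" using C by simp
next
  assume inf: "infinite (connected_in E `` {x})"
  hence "connected_in E `` {x} \<noteq> {}" by (metis finite.emptyI)
  hence "x \<in> E" by (auto simp: connected_in_def)
  thus "\<exists>C\<in>clusters E. x \<in> C \<and> infinite C"
    using inf by (auto simp: clusters_def quotient_def intro!: connected_in_refl)
qed

lemma infinite_iff_unbounded_l1:
  fixes S :: "(int ^ 'd) set"
  shows "infinite S \<longleftrightarrow> (\<forall>N :: nat. \<exists>y\<in>S. int N \<le> l1 (y - x))"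
proof
  assume inf: "infinite S"
  show "\<forall>N :: nat. \<exists>y\<in>S. int N \<le> l1 (y - x)"
  proof (rule ccontr)
    assume "\<not> (\<forall>N :: nat. \<exists>y\<in>S. int N \<le> l1 (y - x))"
    then obtain N :: nat where "\<And>y. y \<in> S \<Longrightarrow> l1 (y - x) \<le> int N" by (meson nle_le)
    hence "S \<subseteq> (\<lambda>z. z + x) ` {z. l1 z \<le> int N}" by (force intro: image_eqI[of _ _ "_ - x"])
    thus False using inf by (auto dest: finite_subset)
  qed
next
  assume unb: "\<forall>N :: nat. \<exists>y\<in>S. int N \<le> l1 (y - x)"
  show "infinite S"
  proof
    assume fin: "finite S"
    define N where "N = nat (\<Sum>y\<in>S. l1 (y - x)) + 1"
    obtain y where y: "y \<in> S" "int N \<le> l1 (y - x)" using unb by blast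
    have "l1 (y - x) \<le> (\<Sum>y\<in>S. l1 (y - x))"
      using fin y by (intro member_le_sum) auto
    thus False using y by (simp add: N_def split: if_splits)
  qed
qed

text \<open>A discrete intermediate value theorem: one step changes the distance from \<open>u\<close> by at most \<open>1\<close>.\<close>
lemma path_intermediate_distance:
  assumes "(u, w) \<in> (induced_edges E)\<^sup>*" "0 \<le> r" "r \<le> l1 (w - u)"
  shows "\<exists>v. (u, v) \<in> (induced_edges E)\<^sup>* \<and> (v, w) \<in> (induced_edges E)\<^sup>* \<and> l1 (v - u) = r"
  using assms
proof (induction rule: rtrancl_induct)
  case base
  thus ?case by auto
next
  case (step y z)
  show ?case
  proof (cases "r \<le> l1 (y - u)")
    case True
    with step show ?thesis by (meson rtrancl.rtrancl_into_rtrancl)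
  next
    case False
    have "l1 (z - y) = 1" using step.hyps
      by (auto simp: induced_edges_def adjacent_iff_l1 l1_minus_commute)
    hence "l1 (z - u) \<le> 1 + l1 (y - u)" using l1_triangle_minus[of z u y] by simp
    hence "l1 (z - u) = r" using False step.prems by linarith
    moreover have "(u, z) \<in> (induced_edges E)\<^sup>*"
      using step.hyps by (rule rtrancl.rtrancl_into_rtrancl)
    ultimately show ?thesis by blast
  qed
qed

section \<open>No percolation at high levels\<close>
definition cell :: "nat \<Rightarrow> int ^ 'd \<Rightarrow> int ^ 'd" where
  "cell n x = (\<chi> i. x $ i div 16 ^ n)"

text \<open>The possible pairs of cells of one scale for the two halves of a tree that starts in the cell \<open>z\<close> of the next
  scale: the first is a subcell of \<open>z\<close>, the second starts at distance half of the next scale, that is, eight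
  cell widths, from a point of the first, and rounding adds one more cell.\<close>
definition branch_pairs :: "int ^ 'd \<Rightarrow> ((int ^ 'd) \<times> (int ^ 'd)) set" where
  "branch_pairs z = {(z1, z2). cell 1 z1 = z \<and> (\<forall>i. \<bar>z2 $ i - z1 $ i\<bar> \<le> 9)}"

text \<open>A tree of depth \<open>n\<close> is recorded by its \<open>2 ^ n\<close> leaves. The separation condition makes the two halves
  distant on the scale \<open>16 ^ n\<close>, so that their correlation is small.\<close>
fun tree_sets :: "nat \<Rightarrow> int ^ 'd \<Rightarrow> (int ^ 'd) set set" where
  "tree_sets 0 z = {{z}}"
| "tree_sets (Suc n) z = (\<Union>(z1, z2)\<in>branch_pairs z.
     (\<lambda>(t1, t2). t1 \<union> t2) ` {(t1, t2) \<in> tree_sets n z1 \<times> tree_sets n z2. \<forall>x\<in>t1. \<forall>y\<in>t2. 4 * 16 ^ n \<le> l1 (x - y)})"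

declare tree_sets.simps(2) [simp del]

lemma tree_sets_SucE:
  assumes "t \<in> tree_sets (Suc n) z"
  obtains z1 z2 t1 t2 where "t = t1 \<union> t2" "(z1, z2) \<in> branch_pairs z" "t1 \<in> tree_sets n z1" "t2 \<in> tree_sets n z2"
    "\<forall>x\<in>t1. \<forall>y\<in>t2. 4 * 16 ^ n \<le> l1 (x - y)"
proof -
  from assms obtain p where p: "p \<in> branch_pairs z" and t: "t \<in> (case p of (z1, z2) \<Rightarrow>
     (\<lambda>(t1, t2). t1 \<union> t2) ` {(t1, t2) \<in> tree_sets n z1 \<times> tree_sets n z2. \<forall>x\<in>t1. \<forall>y\<in>t2. 4 * 16 ^ n \<le> l1 (x - y)})"
    unfolding tree_sets.simps by (rule UN_E)
  obtain z1 z2 where pz: "p = (z1, z2)" by (cases p)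
  have z: "(z1, z2) \<in> branch_pairs z" using p pz by simp
  have
    "t \<in> (\<lambda>(t1, t2). t1 \<union> t2) ` {(t1, t2) \<in> tree_sets n z1 \<times> tree_sets n z2.
       \<forall>x\<in>t1. \<forall>y\<in>t2. 4 * 16 ^ n \<le> l1 (x - y)}"
    using t unfolding pz by simp
  then obtain t1 t2 where "t = t1 \<union> t2" "t1 \<in> tree_sets n z1" "t2 \<in> tree_sets n z2"
    "\<forall>x\<in>t1. \<forall>y\<in>t2. 4 * 16 ^ n \<le> l1 (x - y)"
    by auto
  thus ?thesis using that z by blast
qed

lemma cell_Suc: "cell 1 (cell n x) = cell (Suc n) x"
proof -
  have "a div 16 ^ n div 16 = a div 16 ^ Suc n" for a :: int
    using zdiv_zmult2_eq[of 16 a "16 ^ n"] by (simp add: mult.commute)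
  thus ?thesis by (simp add: cell_def vec_eq_iff)
qed

lemma card_branch_pairs:
  fixes z :: "int ^ 'd"
  shows "finite (branch_pairs z)" "card (branch_pairs z) \<le> 304 ^ CARD('d)"
proof -
  define A where "A = PiE (UNIV :: 'd set) (\<lambda>_. {0..15 :: int}) \<times> PiE (UNIV :: 'd set) (\<lambda>_. {-9..9 :: int})"
  define f where "f = (\<lambda>(r, s). ((\<chi> i. 16 * z $ i + r i) :: int ^ 'd, (\<chi> i. 16 * z $ i + r i + s i) :: int ^ 'd))"
  have "branch_pairs z \<subseteq> f ` A"
  proof
    fix p assume "p \<in> branch_pairs z"
    then obtain z1 z2 where p: "p = (z1, z2)" "\<And>i. z1 $ i div 16 = z $ i" "\<And>i. \<bar>z2 $ i - z1 $ i\<bar> \<le> 9"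
      by (auto simp: branch_pairs_def cell_def vec_eq_iff)
    have "p = f (\<lambda>i. z1 $ i mod 16, \<lambda>i. z2 $ i - z1 $ i)"
      unfolding p(1) f_def by (auto simp: vec_eq_iff p(2)[symmetric])
    moreover have "z1 $ i mod 16 \<in> {0..15}" "z2 $ i - z1 $ i \<in> {-9..9}" for i
      using pos_mod_bound[of 16 "z1 $ i"] p(3)[of i] by (auto simp: abs_le_iff)
    hence "(\<lambda>i. z1 $ i mod 16, \<lambda>i. z2 $ i - z1 $ i) \<in> A" by (auto simp: A_def)
    ultimately show "p \<in> f ` A" by blast
  qed
  moreover have A: "finite A" "card A = 304 ^ CARD('d)"
    by (auto simp: A_def card_cartesian_product card_PiE intro!: finite_PiE simp flip: power_mult_distrib)
  ultimately show "finite (branch_pairs z)" "card (branch_pairs z) \<le> 304 ^ CARD('d)"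
    using finite_subset[of "branch_pairs z" "f ` A"] card_mono[of "f ` A" "branch_pairs z"] card_image_le[of A f]
    by (auto intro: order.trans)
qed

text \<open>With \<open>L\<close> the bound on the number of branch pairs, the numbers \<open>M n\<close> of trees satisfy
  \<open>M (n + 1) \<le> L * (M n)\<^sup>2\<close>; the factor on the left makes this a plain squaring of \<open>L * M n\<close>.\<close>
lemma card_tree_sets:
  fixes z :: "int ^ 'd"
  shows "finite (tree_sets n z) \<and> 304 ^ CARD('d) * card (tree_sets n z) \<le> (304 ^ CARD('d)) ^ (2 ^ n)"
proof (induction n arbitrary: z)
  case (Suc n)
  define L :: nat where "L = 304 ^ CARD('d)"
  define f where "f = (\<lambda>(z1 :: int ^ 'd, z2 :: int ^ 'd). 
     (\<lambda>(t1, t2). t1 \<union> t2) ` {(t1, t2) \<in> tree_sets n z1 \<times> tree_sets n z2. \<forall>x\<in>t1. \<forall>y\<in>t2. 4 * 16 ^ n \<le> l1 (x - y)})"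
  note IH = Suc.IH[folded L_def]
  have f: "finite (f p) \<and> L * L * card (f p) \<le> L ^ (2 ^ Suc n)" for p
  proof -
    obtain z1 z2 where p: "p = (z1, z2)" by force
    let ?S = "{(t1, t2) \<in> tree_sets n z1 \<times> tree_sets n z2. \<forall>x\<in>t1. \<forall>y\<in>t2. 4 * 16 ^ n \<le> l1 (x - y)}"
    have fin: "finite (tree_sets n z1 \<times> tree_sets n z2)" using IH by auto
    have S: "?S \<subseteq> tree_sets n z1 \<times> tree_sets n z2" by auto
    have "card (f p) \<le> card ?S" unfolding f_def p case_prod_conv
      by (rule card_image_le) (rule finite_subset[OF S fin])
    also have "\<dots> \<le> card (tree_sets n z1) * card (tree_sets n z2)"
      using card_mono[OF fin S] by (simp add: card_cartesian_product)
    finally have "L * L * card (f p) \<le> (L * card (tree_sets n z1)) * (L * card (tree_sets n z2))" by (simp add: mult_ac)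
    also have "\<dots> \<le> L ^ (2 ^ n) * L ^ (2 ^ n)" using IH by (intro mult_mono) auto
    also have "\<dots> = L ^ (2 ^ Suc n)" by (simp add: mult_2 flip: power_add)
    finally show ?thesis unfolding f_def p case_prod_conv using finite_subset[OF S fin] by auto
  qed
  have eq: "tree_sets (Suc n) z = (\<Union>p\<in>branch_pairs z. f p)" by (simp add: f_def tree_sets.simps)
  have L0: "L > 0" by (simp add: L_def)
  have "L * (L * card (tree_sets (Suc n) z)) \<le> L * (L * (\<Sum>p\<in>branch_pairs z. card (f p)))"
    unfolding eq by (intro mult_left_mono card_UN_le card_branch_pairs) auto
  also have "\<dots> = (\<Sum>p\<in>branch_pairs z. L * L * card (f p))" by (simp add: sum_distrib_left mult_ac)
  also have "\<dots> \<le> (\<Sum>p\<in>branch_pairs z. L ^ (2 ^ Suc n))" using f by (intro sum_mono) auto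
  also have "\<dots> = card (branch_pairs z) * L ^ (2 ^ Suc n)" by simp
  also have "\<dots> \<le> L * L ^ (2 ^ Suc n)" using card_branch_pairs(2)[of z] by (intro mult_right_mono) (auto simp: L_def)
  finally have "L * card (tree_sets (Suc n) z) \<le> L ^ (2 ^ Suc n)" using L0 by simp
  moreover have "finite (tree_sets (Suc n) z)"
    unfolding eq by (rule finite_UN_I[OF card_branch_pairs(1)]) (use f in blast)
  ultimately show ?case by (simp add: L_def)
qed auto

text \<open>A path to distance \<open>16 ^ (n + 1)\<close> passes through a point \<open>v\<close> at exactly half that distance. Both its initial
  piece and its piece after \<open>v\<close> reach distance \<open>16 ^ n\<close> from their starting points, and the trees found in
  them stay within \<open>16 ^ n\<close> of these points, hence \<open>6 * 16 ^ n\<close> apart.\<close>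
lemma tree_in_cluster:
  assumes "(u, w) \<in> (induced_edges E)\<^sup>*" "u \<in> E" "16 ^ n \<le> l1 (w - u)"
  shows "\<exists>t\<in>tree_sets n (cell n u). t \<subseteq> E \<and> (\<forall>x\<in>t. l1 (x - u) \<le> 16 ^ n)"
  using assms
proof (induction n arbitrary: u w)
  case 0
  thus ?case by (auto simp: cell_def vec_eq_iff)
next
  case (Suc n)
  define r where "r = (8 * 16 ^ n :: int)"
  obtain v where v: "(u, v) \<in> (induced_edges E)\<^sup>*" "(v, w) \<in> (induced_edges E)\<^sup>*" "l1 (v - u) = r"
  proof -
    have "0 \<le> r" by (simp add: r_def)
    moreover have "r \<le> 16 ^ Suc n" by (simp add: r_def)
    hence "r \<le> l1 (w - u)" using Suc.prems(3) by (rule order.trans)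
    ultimately show ?thesis using path_intermediate_distance[OF Suc.prems(1)] that by blast
  qed
  have vE: "v \<in> E" using v(1) Suc.prems(2) by (induction rule: rtrancl_induct) (auto simp: induced_edges_def)
  have vw: "l1 (w - u) \<le> l1 (w - v) + r" using l1_triangle_minus[of w u v] v(3) by simp
  obtain t1 where t1: "t1 \<in> tree_sets n (cell n u)" "t1 \<subseteq> E" "\<And>x. x \<in> t1 \<Longrightarrow> l1 (x - u) \<le> 16 ^ n"
  proof -
    have "(16 :: int) ^ n \<le> 16 ^ Suc n" by simp
    thus ?thesis using Suc.IH[OF Suc.prems(1,2)] Suc.prems(3) that by (meson order.trans)
  qed
  obtain t2 where t2: "t2 \<in> tree_sets n (cell n v)" "t2 \<subseteq> E" "\<And>x. x \<in> t2 \<Longrightarrow> l1 (x - v) \<le> 16 ^ n"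
  proof -
    have "16 ^ n \<le> l1 (w - v)" using Suc.prems(3) vw zero_le_power[of "16 :: int" n] unfolding r_def power_Suc by linarith
    thus ?thesis using Suc.IH[OF v(2) vE] that by blast
  qed
  have sep: "4 * 16 ^ n \<le> l1 (x - y)" if "x \<in> t1" "y \<in> t2" for x y
  proof -
    have "r \<le> l1 (v - y) + l1 (y - x) + l1 (x - u)"
      using l1_triangle_minus[of v u y] l1_triangle_minus[of y u x] v(3) by linarith
    thus ?thesis using t1(3)[OF that(1)] t2(3)[OF that(2)] zero_le_power[of "16 :: int" n]
      unfolding r_def l1_minus_commute[of v y] l1_minus_commute[of y x] by linarith
  qed
  have "\<bar>v $ i div 16 ^ n - u $ i div 16 ^ n\<bar> \<le> 9" for i
  proof -
    have "\<bar>v $ i - u $ i\<bar> \<le> 8 * 16 ^ n" using abs_component_le_l1[of "v - u" i] v(3) by (simp add: r_def)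
    hence le: "v $ i \<le> u $ i + 8 * 16 ^ n" "u $ i \<le> v $ i + 8 * 16 ^ n" by auto
    have "(0 :: int) < 16 ^ n" by simp
    from zdiv_mono1[OF le(1) this] zdiv_mono1[OF le(2) this] show ?thesis by simp
  qed
  hence "(cell n u, cell n v) \<in> branch_pairs (cell (Suc n) u)"
    using cell_Suc[of n u] by (auto simp: branch_pairs_def) (auto simp: cell_def)
  hence "t1 \<union> t2 \<in> tree_sets (Suc n) (cell (Suc n) u)"
    unfolding tree_sets.simps using t1(1) t2(1) sep by blast
  moreover have "l1 (x - u) \<le> 16 ^ Suc n" if x: "x \<in> t1 \<union> t2" for x
  proof -
    have pos: "(0 :: int) \<le> 16 ^ n" by simp
    consider "x \<in> t1" | "x \<in> t2" using x by blast
    hence "l1 (x - u) \<le> 9 * 16 ^ n"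
    proof cases
      case 1
      thus ?thesis using t1(3)[of x] pos by linarith
    next
      case 2
      thus ?thesis using t2(3)[of x] l1_triangle_minus[of x u v] v(3) unfolding r_def by linarith
    qed
    thus ?thesis using pos unfolding power_Suc by linarith
  qed
  moreover have "t1 \<union> t2 \<subseteq> E" using t1(2) t2(2) by simp
  ultimately show ?case by (intro bexI[of _ "t1 \<union> t2"] conjI ballI)
qed

lemma card_tree:
  assumes "t \<in> tree_sets n z"
  shows "finite t \<and> card t = 2 ^ n"
  using assms
proof (induction n arbitrary: z t)
  case (Suc n)
  obtain z1 z2 t1 t2 where t: "t = t1 \<union> t2" "(z1, z2) \<in> branch_pairs z" "t1 \<in> tree_sets n z1" "t2 \<in> tree_sets n z2"
    "\<forall>x\<in>t1. \<forall>y\<in>t2. 4 * 16 ^ n \<le> l1 (x - y)"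
    using Suc.prems by (rule tree_sets_SucE) blast
  have False if "x \<in> t1" "x \<in> t2" for x
  proof -
    have "4 * 16 ^ n \<le> l1 (x - x)" using t(5) that by blast
    moreover have "l1 (x - x) = 0" by simp
    ultimately show False using zero_less_power[of "16 :: int" n] by linarith
  qed
  hence "t1 \<inter> t2 = {}" by blast
  thus ?case using Suc.IH[OF t(3)] Suc.IH[OF t(4)] by (simp add: t(1) card_Un_disjoint)
qed auto

context gff begin

text \<open>The \<open>4 ^ n\<close> covariances between the two halves of a tree of depth \<open>n + 1\<close> are at most \<open>C / 4 ^ n\<close> each, so a
  level adds only \<open>2 * C\<close> to twice the previous variance; the subtracted \<open>2 * C\<close> carries the induction.\<close>
lemma variance_tree:
  assumes C: "\<And>x y :: int ^ 'd. green x y \<le> C" "\<And>k (x :: int ^ 'd) y. 16 ^ k \<le> l1 (x - y) \<Longrightarrow> green x y \<le> C / 4 ^ k" "C > 0"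
    and "t \<in> tree_sets n (z :: int ^ 'd)"
  shows "(\<Sum>x\<in>t. \<Sum>y\<in>t. green x y) \<le> 3 * C * 2 ^ n - 2 * C"
  using assms(4)
proof (induction n arbitrary: z t)
  case 0
  thus ?case using C(1) by auto
next
  case (Suc n)
  obtain z1 z2 t1 t2 where t: "t = t1 \<union> t2" "(z1, z2) \<in> branch_pairs z" "t1 \<in> tree_sets n z1" "t2 \<in> tree_sets n z2"
    "\<forall>x\<in>t1. \<forall>y\<in>t2. 4 * 16 ^ n \<le> l1 (x - y)"
    using Suc.prems by (rule tree_sets_SucE) blast
  have False if "x \<in> t1" "x \<in> t2" for x
  proof -
    have "4 * 16 ^ n \<le> l1 (x - x)" using t(5) that by blast
    moreover have "l1 (x - x) = 0" by simp
    ultimately show False using zero_less_power[of "16 :: int" n] by linarith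
  qed
  hence disj: "t1 \<inter> t2 = {}" by blast
  note fin = card_tree[OF t(3)] card_tree[OF t(4)]
  have "(\<Sum>x\<in>t1. \<Sum>y\<in>t2. green x y) \<le> (\<Sum>x\<in>t1. \<Sum>y\<in>t2. C / 4 ^ n)"
  proof (intro sum_mono C(2))
    fix x y assume "x \<in> t1" "y \<in> t2"
    have "(16 :: int) ^ n \<le> 4 * 16 ^ n" by simp
    also have "\<dots> \<le> l1 (x - y)" using t(5) \<open>x \<in> t1\<close> \<open>y \<in> t2\<close> by blast
    finally show "16 ^ n \<le> l1 (x - y)" .
  qed
  also have "\<dots> = C"
  proof -
    have "(4 :: real) ^ n = 2 ^ n * 2 ^ n" by (simp flip: power_mult_distrib)
    thus ?thesis using fin by simp
  qed
  finally have cross: "(\<Sum>x\<in>t1. \<Sum>y\<in>t2. green x y) \<le> C" .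
  have "(\<Sum>x\<in>t2. \<Sum>y\<in>t1. green x y) = (\<Sum>x\<in>t1. \<Sum>y\<in>t2. green x y)"
    by (subst sum.swap) (simp add: green_commute)
  hence "(\<Sum>x\<in>t. \<Sum>y\<in>t. green x y) = (\<Sum>x\<in>t1. \<Sum>y\<in>t1. green x y) + (\<Sum>x\<in>t2. \<Sum>y\<in>t2. green x y) +
      2 * (\<Sum>x\<in>t1. \<Sum>y\<in>t2. green x y)"
    using fin disj by (simp add: t(1) sum.union_disjoint sum.distrib)
  thus ?case using Suc.IH[OF t(3)] Suc.IH[OF t(4)] cross by simp
qed

lemma excursion_tree_bound:
  assumes C: "\<And>x y :: int ^ 'd. green x y \<le> C" "\<And>k (x :: int ^ 'd) y. 16 ^ k \<le> l1 (x - y) \<Longrightarrow> green x y \<le> C / 4 ^ k" "C > 0"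
    and t: "t \<in> tree_sets n (z :: int ^ 'd)" and h: "h > 0"
  shows "{\<phi>. \<forall>x\<in>t. \<phi> x \<ge> h} \<in> events" "prob {\<phi>. \<forall>x\<in>t. \<phi> x \<ge> h} \<le> exp (- h\<^sup>2 / (6 * C)) ^ (2 ^ n)"
proof -
  note fin = card_tree[OF t]
  let ?W = "linear_comb (\<lambda>x (\<phi> :: int ^ 'd \<Rightarrow> real). \<phi> x) t (\<lambda>_. 1)"
  show "{\<phi>. \<forall>x\<in>t. \<phi> x \<ge> h} \<in> events"
    using cylinder_sets[of t "\<lambda>_. {h..}"] fin by simp
  have W: "is_comb ?W" using fin by (intro is_comb_linear_comb is_comb_coord) auto
  note [measurable] = is_comb_measurable[OF W]
  have "{\<phi>. \<forall>x\<in>t. \<phi> x \<ge> h} \<subseteq> {\<phi> \<in> space P. ?W \<phi> \<ge> h * 2 ^ n}"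
  proof safe
    fix \<phi> :: "int ^ 'd \<Rightarrow> real" assume "\<forall>x\<in>t. \<phi> x \<ge> h"
    hence "(\<Sum>x\<in>t. h) \<le> (\<Sum>x\<in>t. \<phi> x)" by (intro sum_mono) auto
    thus "h * 2 ^ n \<le> ?W \<phi>" using fin by (simp add: linear_comb_def mult.commute)
  qed auto
  hence "prob {\<phi>. \<forall>x\<in>t. \<phi> x \<ge> h} \<le> prob {\<phi> \<in> space P. ?W \<phi> \<ge> h * 2 ^ n}"
    by (rule finite_measure_mono) measurable
  also have "\<dots> \<le> exp (- (h * 2 ^ n)\<^sup>2 / (2 * (3 * C * 2 ^ n)))"
  proof (rule gaussian_rv_tail[OF is_comb_gaussian[OF W]])
    have "expectation (\<lambda>\<phi>. (?W \<phi>)\<^sup>2) = (\<Sum>x\<in>t. \<Sum>y\<in>t. green x y)"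
      using covariance_linear_comb[of t t "\<lambda>x. x" "\<lambda>_. 1" "\<lambda>x. x" "\<lambda>_. 1"] fin by (simp add: power2_eq_square)
    also have "\<dots> \<le> 3 * C * 2 ^ n - 2 * C" by (rule variance_tree[OF C t])
    finally show "expectation (\<lambda>\<phi>. (?W \<phi>)\<^sup>2) \<le> 3 * C * 2 ^ n" using C(3) by simp
  qed (use C h in auto)
  also have "- (h * 2 ^ n)\<^sup>2 / (2 * (3 * C * 2 ^ n)) = real (2 ^ n) * (- h\<^sup>2 / (6 * C))"
    by (simp add: power2_eq_square field_simps)
  also have "exp \<dots> = exp (- h\<^sup>2 / (6 * C)) ^ (2 ^ n)" by (rule exp_of_nat_mult)
  finally show "prob {\<phi>. \<forall>x\<in>t. \<phi> x \<ge> h} \<le> exp (- h\<^sup>2 / (6 * C)) ^ (2 ^ n)" .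
qed

text \<open>The level is chosen such that the entropy factor \<open>L\<close> of the trees times the cost of a single leaf equals \<open>1/2\<close>.\<close>
lemma eta_zero_high_level: "\<exists>h. eta P h = 0"
proof -
  obtain C where C: "C > 0" "\<And>x y :: int ^ 'd. green x y \<le> C"
      "\<And>k (x :: int ^ 'd) y. 16 ^ k \<le> l1 (x - y) \<Longrightarrow> green x y \<le> C / 4 ^ k"
    using green_decay[OF dim] by blast
  define L :: real where "L = 304 ^ CARD('d)"
  have L: "L \<ge> 1" by (simp add: L_def)
  define h where "h = sqrt (6 * C * ln (2 * L))"
  have h: "h > 0" using C(1) L by (simp add: h_def)
  have hL: "L * exp (- h\<^sup>2 / (6 * C)) = 1 / 2"
  proof -
    have "h\<^sup>2 = 6 * C * ln (2 * L)" using C(1) L by (simp add: h_def)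
    hence "exp (- h\<^sup>2 / (6 * C)) = 1 / (2 * L)" using C(1) L by (simp add: exp_minus inverse_eq_divide)
    thus ?thesis using L by simp
  qed
  have "eta P h \<le> (1 / 2) ^ n" for n
  proof -
    have sub: "origin_percolates P h \<subseteq> (\<Union>t\<in>tree_sets n (0 :: int ^ 'd). {\<phi>. \<forall>x\<in>t. \<phi> x \<ge> h})"
    proof
      fix \<phi> assume "\<phi> \<in> origin_percolates P h"
      hence "infinite (connected_in (excursion_set h \<phi>) `` {0})"
        by (simp add: origin_percolates_def in_infinite_cluster_iff)
      hence "\<exists>w\<in>connected_in (excursion_set h \<phi>) `` {0}. int (16 ^ n) \<le> l1 (w - 0)"
        using infinite_iff_unbounded_l1[of _ 0] by blast
      then obtain w where "(0, w) \<in> (induced_edges (excursion_set h \<phi>))\<^sup>*" "0 \<in> excursion_set h \<phi>" "16 ^ n \<le> l1 (w - 0)"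
        by (auto simp: connected_in_def)
      from tree_in_cluster[OF this] obtain t where "t \<in> tree_sets n (cell n 0)" "t \<subseteq> excursion_set h \<phi>" by blast
      moreover have "cell n (0 :: int ^ 'd) = 0" by (simp add: cell_def vec_eq_iff)
      ultimately show "\<phi> \<in> (\<Union>t\<in>tree_sets n (0 :: int ^ 'd). {\<phi>. \<forall>x\<in>t. \<phi> x \<ge> h})"
        by (auto simp: excursion_set_def)
    qed
    note T = card_tree_sets[of n "0 :: int ^ 'd"]
    note B = excursion_tree_bound[OF C(2,3,1) _ h]
    have "eta P h \<le> prob (\<Union>t\<in>tree_sets n (0 :: int ^ 'd). {\<phi>. \<forall>x\<in>t. \<phi> x \<ge> h})"
      unfolding eta_def using T B(1) by (intro finite_measure_mono[OF sub] sets.finite_UN) auto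
    also have "\<dots> \<le> (\<Sum>t\<in>tree_sets n (0 :: int ^ 'd). prob {\<phi>. \<forall>x\<in>t. \<phi> x \<ge> h})"
      using T B(1) by (intro finite_measure_subadditive_finite) auto
    also have "\<dots> \<le> (\<Sum>t\<in>tree_sets n (0 :: int ^ 'd). exp (- h\<^sup>2 / (6 * C)) ^ (2 ^ n))"
      using B(2) by (intro sum_mono)
    also have "\<dots> = real (card (tree_sets n (0 :: int ^ 'd))) * exp (- h\<^sup>2 / (6 * C)) ^ (2 ^ n)" by simp
    also have "\<dots> \<le> L ^ (2 ^ n) * exp (- h\<^sup>2 / (6 * C)) ^ (2 ^ n)"
    proof (rule mult_right_mono)
      have "card (tree_sets n (0 :: int ^ 'd)) \<le> 304 ^ CARD('d) * card (tree_sets n (0 :: int ^ 'd))" by simp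
      also have "\<dots> \<le> (304 ^ CARD('d)) ^ (2 ^ n)" using T by blast
      finally have "real (card (tree_sets n (0 :: int ^ 'd))) \<le> real ((304 ^ CARD('d)) ^ (2 ^ n))" 
        by (simp only: of_nat_le_iff)
      thus "real (card (tree_sets n (0 :: int ^ 'd))) \<le> L ^ (2 ^ n)" by (simp add: L_def)
    qed simp
    also have "\<dots> = (1 / 2) ^ (2 ^ n)" by (simp only: power_mult_distrib[symmetric] hL)
    also have "\<dots> \<le> (1 / 2) ^ n" by (intro power_decreasing) (auto intro: less_imp_le less_exp)
    finally show ?thesis .
  qed
  moreover have "(\<lambda>n. (1 / 2 :: real) ^ n) \<longlonglongrightarrow> 0" by (rule LIMSEQ_realpow_zero) auto
  ultimately have "eta P h \<le> 0" by (intro LIMSEQ_le_const[of _ 0 "eta P h"]) auto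
  moreover have "eta P h \<ge> 0" by (simp add: eta_def)
  ultimately show ?thesis by (intro exI[of _ h]) simp
qed

end

section \<open>Percolation events\<close>

context gff begin

text \<open>The restriction to a set \<open>B\<close> of sites serves the exploration from a sphere, where only paths inside a ball count.\<close>
lemma connected_within_event [measurable]:
  "Measurable.pred P (\<lambda>\<phi>. (x, y) \<in> connected_in (excursion_set h \<phi> \<inter> B))"
proof -
  have edge [measurable]: "Measurable.pred P (\<lambda>\<phi>. (z, y) \<in> induced_edges (excursion_set h \<phi> \<inter> B))" for z y
    unfolding induced_edges_def excursion_set_def by simp
  have [measurable]: "Measurable.pred P (\<lambda>\<phi>. (x, y) \<in> induced_edges (excursion_set h \<phi> \<inter> B) ^^ n)" for n y
    by (induction n arbitrary: y) (simp_all add: relcomp_unfold)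
  have "Measurable.pred P (\<lambda>\<phi>. (h \<le> \<phi> x \<and> x \<in> B) \<and> (h \<le> \<phi> y \<and> y \<in> B) \<and>
      (\<exists>n. (x, y) \<in> induced_edges (excursion_set h \<phi> \<inter> B) ^^ n))"
    by measurable
  thus ?thesis by (simp add: connected_in_def rtrancl_power excursion_set_def)
qed

lemma connected_event [measurable]:
  "Measurable.pred P (\<lambda>\<phi>. (x, y) \<in> connected_in (excursion_set h \<phi>))"
  using connected_within_event[of x y h UNIV] by simp

definition percolates_at :: "real \<Rightarrow> int ^ 'd \<Rightarrow> (int ^ 'd \<Rightarrow> real) set" where
  "percolates_at h x = {\<phi>. infinite (connected_in (excursion_set h \<phi>) `` {x})}"

lemma percolates_at_event [measurable]: "percolates_at h x \<in> events"
proof -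
  have "percolates_at h x = {\<phi> \<in> space P. \<forall>N :: nat. \<exists>y. (x, y) \<in> connected_in (excursion_set h \<phi>) \<and> int N \<le> l1 (y - x)}"
    using infinite_iff_unbounded_l1[of "connected_in (excursion_set h _) `` {x}" x]
    by (auto simp: percolates_at_def Bex_def)
  moreover have "Measurable.pred P (\<lambda>\<phi>. \<forall>N :: nat. \<exists>y. (x, y) \<in> connected_in (excursion_set h \<phi>) \<and> int N \<le> l1 (y - x))"
    by measurable
  ultimately show ?thesis unfolding pred_def by simp
qed

lemma origin_percolates_eq: "origin_percolates P h = percolates_at h 0"
  by (simp add: origin_percolates_def percolates_at_def in_infinite_cluster_iff)

lemma has_infinite_cluster_eq: "has_infinite_cluster P h = (\<Union>x. percolates_at h x)"
proof -
  have "(\<exists>C\<in>clusters E. infinite C) \<longleftrightarrow> (\<exists>x. \<exists>C\<in>clusters E. x \<in> C \<and> infinite C)" for E :: "(int ^ 'd) set"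
    by (metis finite.emptyI ex_in_conv)
  thus ?thesis by (auto simp: has_infinite_cluster_def percolates_at_def in_infinite_cluster_iff)
qed

lemma has_infinite_cluster_event [measurable]: "has_infinite_cluster P h \<in> events"
  unfolding has_infinite_cluster_eq by (rule sets.countable_UN'') auto

lemma connected_in_translate:
  assumes "(a, b) \<in> connected_in (excursion_set h (translate v \<phi>))"
  shows "(a + v, b + v) \<in> connected_in (excursion_set h \<phi>)"
proof -
  have "(a, b) \<in> (induced_edges (excursion_set h (translate v \<phi>)))\<^sup>*"
    using assms by (simp add: connected_in_def)
  hence "(a + v, b + v) \<in> (induced_edges (excursion_set h \<phi>))\<^sup>*"
  proof (induction rule: rtrancl_induct)
    case (step y z)
    have "(y + v, z + v) \<in> induced_edges (excursion_set h \<phi>)"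
      using step.hyps(2) by (simp add: induced_edges_def excursion_set_def translate_def)
    with step.IH show ?case by (rule rtrancl.rtrancl_into_rtrancl)
  qed auto
  thus ?thesis using assms by (auto simp: connected_in_def excursion_set_def translate_def)
qed

lemma translate_vimage_percolates: "translate v -` percolates_at h x = percolates_at h (x + v)"
proof -
  have "connected_in (excursion_set h \<phi>) `` {x + v} = (\<lambda>y. y + v) ` (connected_in (excursion_set h (translate v \<phi>)) `` {x})" for \<phi>
  proof -
    have "(x, y - v) \<in> connected_in (excursion_set h (translate v \<phi>))" if "(x + v, y) \<in> connected_in (excursion_set h \<phi>)" for y
      using connected_in_translate[of "x + v" y h "- v" "translate v \<phi>"] that by (simp add: translate_def)
    thus ?thesis by (auto intro: connected_in_translate image_eqI[of _ _ "_ - v"])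
  qed
  moreover have "finite ((\<lambda>y. y + v) ` S) \<longleftrightarrow> finite S" for S :: "(int ^ 'd) set"
    by (rule finite_image_iff) (auto simp: inj_on_def)
  ultimately show ?thesis by (auto simp: percolates_at_def)
qed

lemma prob_translate: "A \<in> events \<Longrightarrow> prob (translate v -` A) = prob A"
  using arg_cong[OF translation_invariant[of v], of "\<lambda>M. measure M A"] by (simp add: measure_distr)

lemma prob_percolates_at: "prob (percolates_at h x) = eta P h"
  using prob_translate[of "percolates_at h 0" x]
  by (simp add: translate_vimage_percolates eta_def origin_percolates_eq)

lemma prob_has_infinite_cluster_0:
  assumes "eta P h = 0"
  shows "prob (has_infinite_cluster P h) = 0"
proof -
  have "percolates_at h x \<in> null_sets P" for x
    using assms by (intro null_setsI) (auto simp: emeasure_eq_measure prob_percolates_at)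
  hence "has_infinite_cluster P h \<in> null_sets P"
    unfolding has_infinite_cluster_eq by (intro null_sets_UN') auto
  thus ?thesis by (auto simp: null_sets_def measure_def)
qed

lemma eta_antimono:
  assumes "h \<le> h'"
  shows "eta P h' \<le> eta P h"
proof -
  have "percolates_at h' 0 \<subseteq> percolates_at h 0"
  proof
    fix \<phi> assume "\<phi> \<in> percolates_at h' 0"
    moreover have "excursion_set h' \<phi> \<subseteq> excursion_set h \<phi>" using assms by (auto simp: excursion_set_def)
    hence "connected_in (excursion_set h' \<phi>) `` {0} \<subseteq> connected_in (excursion_set h \<phi>) `` {0}"
      using connected_in_mono by blast
    ultimately show "\<phi> \<in> percolates_at h 0" by (auto simp: percolates_at_def dest: finite_subset)
  qed
  thus ?thesis unfolding eta_def origin_percolates_eq by (intro finite_measure_mono) auto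
qed

end

section \<open>The zero-one law\<close>
lemma iexp_add: "iexp (x + y) = iexp x * iexp y"
  by (simp add: exp_add distrib_left)

lemma cnj_iexp: "cnj (iexp x) = iexp (- x)"
  by (simp add: exp_cnj)

lemma (in prob_space) norm_expectation_sq_le:
  fixes F :: "'a \<Rightarrow> complex"
  assumes [measurable]: "F \<in> borel_measurable M" "A \<in> events" and bd: "\<And>\<omega>. norm (F \<omega>) \<le> K"
  shows "(norm (\<integral>\<omega>. indicator A \<omega> * F \<omega> \<partial>M))\<^sup>2 \<le> expectation (\<lambda>\<omega>. (norm (F \<omega>))\<^sup>2)"
proof -
  have i: "integrable M (\<lambda>\<omega>. norm (F \<omega>))"
    using bd by (intro integrable_const_bound[where B = K]) auto
  have i2: "integrable M (\<lambda>\<omega>. (norm (F \<omega>))\<^sup>2)"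
    using bd by (intro integrable_const_bound[where B = "K\<^sup>2"]) (auto intro!: power_mono)
  have "norm (\<integral>\<omega>. indicator A \<omega> * F \<omega> \<partial>M) \<le> expectation (\<lambda>\<omega>. norm (F \<omega>))"
  proof (rule order.trans[OF integral_norm_bound])
    have le: "norm (indicator A \<omega> * F \<omega>) \<le> norm (F \<omega>)" for \<omega>
      by (simp add: indicator_def)
    thus "expectation (\<lambda>\<omega>. norm (indicator A \<omega> * F \<omega>)) \<le> expectation (\<lambda>\<omega>. norm (F \<omega>))"
      by (intro integral_mono i integrable_const_bound[where B = K]) (auto intro: order.trans[OF le bd])
  qed
  hence "(norm (\<integral>\<omega>. indicator A \<omega> * F \<omega> \<partial>M))\<^sup>2 \<le> (expectation (\<lambda>\<omega>. norm (F \<omega>)))\<^sup>2"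
    by (intro power_mono) auto
  also have "\<dots> \<le> expectation (\<lambda>\<omega>. (norm (F \<omega>))\<^sup>2)"
    using variance_eq[OF i i2] variance_positive[of "\<lambda>\<omega>. norm (F \<omega>)"] by simp
  finally show ?thesis .
qed

text \<open>A quantitative mean ergodic argument: \<open>z\<close> is the integral over \<open>A\<close> of the average of \<open>N\<close> of the functions, and
  the second moment of this average consists of \<open>N\<close> diagonal terms and at most \<open>N\<^sup>2\<close> small ones, divided by
  \<open>N\<^sup>2\<close>.\<close>
lemma (in prob_space) nearly_orthogonal_average:
  fixes F :: "nat \<Rightarrow> 'a \<Rightarrow> complex"
  assumes [measurable]: "\<And>k. F k \<in> borel_measurable M" "A \<in> events"
    and bd: "\<And>k \<omega>. norm (F k \<omega>) \<le> 2"
    and same: "\<And>k. (\<integral>\<omega>. indicator A \<omega> * F k \<omega> \<partial>M) = z"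
    and orth: "\<And>j k. j \<noteq> k \<Longrightarrow> norm (\<integral>\<omega>. F j \<omega> * cnj (F k \<omega>) \<partial>M) \<le> e"
    and N: "N > 0"
  shows "(norm z)\<^sup>2 \<le> 4 / real N + e"
proof -
  have [measurable]: "(\<lambda>\<omega>. cnj (F k \<omega>)) \<in> borel_measurable M" for k
    by (intro measurable_compose[OF _ borel_measurable_continuous_onI[of cnj]] continuous_intros) auto
  have e0: "e \<ge> 0" using orth[of 0 1] norm_ge_zero by (meson order.trans zero_neq_one)
  have sq: "norm (F j \<omega> * cnj (F k \<omega>)) \<le> 4" for j k \<omega>
    using mult_mono[OF bd[of j \<omega>] bd[of k \<omega>]] by (simp add: norm_mult)
  have i1: "integrable M (\<lambda>\<omega>. F j \<omega> * cnj (F k \<omega>))" for j k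
    by (rule integrable_const_bound[where B = 4]) (use sq in auto)
  have i2: "integrable M (\<lambda>\<omega>. indicator A \<omega> * F k \<omega>)" for k
    by (rule integrable_const_bound[where B = 2]) (use bd in \<open>auto simp: norm_mult indicator_def\<close>)
  define G where "G = (\<lambda>\<omega>. \<Sum>k<N. F k \<omega>)"
  have [measurable]: "G \<in> borel_measurable M" unfolding G_def by measurable
  have "of_nat N * z = (\<integral>\<omega>. (\<Sum>k<N. indicator A \<omega> * F k \<omega>) \<partial>M)"
    by (subst Bochner_Integration.integral_sum) (simp_all only: i2 same sum_constant card_lessThan)
  hence "norm (of_nat N * z) = norm (\<integral>\<omega>. indicator A \<omega> * G \<omega> \<partial>M)"
    by (simp add: G_def sum_distrib_left)
  hence "(real N * norm z)\<^sup>2 = (norm (\<integral>\<omega>. indicator A \<omega> * G \<omega> \<partial>M))\<^sup>2"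
    by (simp add: norm_mult)
  also have "\<dots> \<le> expectation (\<lambda>\<omega>. (norm (G \<omega>))\<^sup>2)"
  proof (rule norm_expectation_sq_le)
    show "norm (G \<omega>) \<le> 2 * real N" for \<omega>
      unfolding G_def using sum_norm_bound[of "{..<N}" "\<lambda>k. F k \<omega>" 2] bd by (simp add: mult.commute)
  qed auto
  also have "\<dots> = norm (complex_of_real (expectation (\<lambda>\<omega>. (norm (G \<omega>))\<^sup>2)))"
    by (simp add: abs_of_nonneg)
  also have "complex_of_real (expectation (\<lambda>\<omega>. (norm (G \<omega>))\<^sup>2)) = (\<integral>\<omega>. (\<Sum>j<N. \<Sum>k<N. F j \<omega> * cnj (F k \<omega>)) \<partial>M)"
    unfolding integral_complex_of_real[symmetric]
    by (intro Bochner_Integration.integral_cong refl) (simp only: complex_norm_square G_def cnj_sum sum_product)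
  also have "\<dots> = (\<Sum>j<N. \<Sum>k<N. (\<integral>\<omega>. F j \<omega> * cnj (F k \<omega>) \<partial>M))"
    using i1 by (simp add: Bochner_Integration.integral_sum)
  also have "norm \<dots> \<le> (\<Sum>j<N. \<Sum>k<N. e + (if j = k then 4 else 0))"
  proof (intro order.trans[OF norm_sum] sum_mono)
    fix j k
    show "norm (\<integral>\<omega>. F j \<omega> * cnj (F k \<omega>) \<partial>M) \<le> e + (if j = k then 4 else 0)"
    proof (cases "j = k")
      case True
      have "norm (\<integral>\<omega>. F j \<omega> * cnj (F k \<omega>) \<partial>M) \<le> expectation (\<lambda>\<omega>. norm (F j \<omega> * cnj (F k \<omega>)))"
        by (rule integral_norm_bound)
      also have "\<dots> \<le> expectation (\<lambda>\<omega>. 4)"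
        using i1 sq by (intro integral_mono integrable_norm) auto
      finally have "norm (\<integral>\<omega>. F j \<omega> * cnj (F k \<omega>) \<partial>M) \<le> expectation (\<lambda>\<omega>. 4)" .
      thus ?thesis using True e0 by (simp add: prob_space)
    qed (use orth in simp)
  qed
  also have "\<dots> = real N * (real N * e + 4)" by (simp add: sum.distrib)
  finally have "real N * (real N * (norm z)\<^sup>2) \<le> real N * (real N * e + 4)"
    by (simp add: power_mult_distrib power2_eq_square mult_ac)
  hence "real N * (norm z)\<^sup>2 \<le> real N * e + 4" using N by simp
  thus ?thesis using N by (simp add: field_simps)
qed

lemma abs_exp_minus_1_le:
  fixes r :: real
  assumes "\<bar>r\<bar> \<le> 1/2"
  shows "\<bar>exp r - 1\<bar> \<le> 2 * \<bar>r\<bar>"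
proof -
  have "exp r \<le> 1 + 2 * \<bar>r\<bar>" using exp_bound_lemma[of r] assms by simp
  moreover have "exp r \<ge> 1 + r" by (rule exp_ge_add_one_self)
  ultimately show ?thesis by linarith
qed

context gff begin

lemma integrable_iexp_comb: "is_comb W \<Longrightarrow> integrable P (\<lambda>\<phi>. iexp (W \<phi>))"
  by (drule is_comb_measurable) (rule integrable_bounded_by_1, auto)

text \<open>Let \<open>f v\<close> be the centered exponential of the translate of \<open>W\<close> by \<open>v\<close>. Its integral over \<open>A\<close> is independent of
  \<open>v\<close> by invariance, and the correlation of \<open>f u\<close> and \<open>f v\<close> is \<open>c\<^sup>2 * (exp (\<rho> u v) - 1)\<close>, where \<open>\<rho> u v\<close> is the
  covariance of the two translates of \<open>W\<close>. The latter is small for all pairs of distinct terms of a sparse sequence of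
  translations, so \<open>nearly_orthogonal_average\<close> forces the integral to vanish.\<close>
lemma invariant_independent_of_char:
  fixes a :: "int ^ 'd \<Rightarrow> real"
  assumes A: "A \<in> events" and inv: "\<And>v. translate v -` A = A" and S: "finite S"
  defines "W \<equiv> linear_comb (\<lambda>x (\<phi> :: int ^ 'd \<Rightarrow> real). \<phi> x) S a"
  shows "(\<integral>\<phi>. indicator A \<phi> * iexp (W \<phi>) \<partial>P) = prob A * (\<integral>\<phi>. iexp (W \<phi>) \<partial>P)"
proof -
  note [measurable] = A
  have combW: "is_comb (\<lambda>\<phi>. W (translate v \<phi>))" for v
  proof -
    have "(\<lambda>\<phi>. W (translate v \<phi>)) = linear_comb (\<lambda>i \<phi>. \<phi> (i + v)) S a"
      by (simp add: fun_eq_iff W_def linear_comb_def translate_def)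
    thus ?thesis using S by (auto intro!: is_comb_linear_comb is_comb_coord)
  qed
  have W0: "is_comb W" using combW[of 0] by (simp add: translate_def)
  note [measurable] = is_comb_measurable[OF combW] is_comb_measurable[OF W0]
  define V where "V = expectation (\<lambda>\<phi>. W \<phi> * W \<phi>)"
  define c where "c = exp (- V / 2)"
  have c: "(\<integral>\<phi>. iexp (W \<phi>) \<partial>P) = complex_of_real c"
    using is_comb_char[OF W0] by (simp add: c_def V_def)
  have c1: "0 < c" "c \<le> 1" by (auto simp: c_def V_def intro!: Bochner_Integration.integral_nonneg)
  define f where "f = (\<lambda>v \<phi>. iexp (W (translate v \<phi>)) - complex_of_real c)"
  have [measurable]: "f v \<in> borel_measurable P" for v unfolding f_def by measurable
  have fbd: "norm (f v \<phi>) \<le> 2" for v \<phi>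
    unfolding f_def using c1 norm_triangle_ineq4[of "iexp (W (translate v \<phi>))" "complex_of_real c"] by simp
  have tr: "(\<integral>\<phi>. g (translate v \<phi>) \<partial>P) = (\<integral>\<phi>. g \<phi> \<partial>P)" if [measurable]: "g \<in> borel_measurable P" for v and g :: "_ \<Rightarrow> complex"
    using integral_distr[OF translate_measurable[of v] that] by (simp add: translation_invariant)
  have tr0: "translate 0 \<phi> = \<phi>" for \<phi> by (simp add: translate_def)
  define z where "z = (\<integral>\<phi>. indicator A \<phi> * f 0 \<phi> \<partial>P)"
  have same: "(\<integral>\<phi>. indicator A \<phi> * f v \<phi> \<partial>P) = z" for v
  proof -
    have "indicator A (translate v \<phi>) = (indicator A \<phi> :: complex)" for \<phi>
      using inv[of v] by (auto simp: indicator_def)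
    moreover have "f 0 (translate v \<phi>) = f v \<phi>" for \<phi> by (simp add: f_def tr0)
    ultimately show ?thesis using tr[of "\<lambda>\<phi>. indicator A \<phi> * f 0 \<phi>" v] by (simp add: z_def)
  qed
  define \<rho> where "\<rho> = (\<lambda>u v. \<Sum>x\<in>S. \<Sum>y\<in>S. a x * a y * green (x + u) (y + v))"
  have cov: "expectation (\<lambda>\<phi>. W (translate u \<phi>) * W (translate v \<phi>)) = \<rho> u v" for u v
    using covariance_linear_comb[OF S S, of "\<lambda>x. x + u" a "\<lambda>x. x + v" a]
    by (simp add: W_def \<rho>_def linear_comb_def translate_def)
  have \<rho>V: "\<rho> v v = V" for v using cov[of 0 0] by (simp add: V_def tr0 \<rho>_def green_shift)
  have corr: "(\<integral>\<phi>. f u \<phi> * cnj (f v \<phi>) \<partial>P) = complex_of_real (c\<^sup>2 * (exp (\<rho> u v) - 1))" for u v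
  proof -
    let ?D = "\<lambda>\<phi>. W (translate u \<phi>) + (- 1) * W (translate v \<phi>)"
    have D: "is_comb ?D" by (intro is_comb_add is_comb_scale combW)
    have e: "(\<integral>\<phi>. iexp (W (translate v \<phi>)) \<partial>P) = c" for v
      using tr[of "\<lambda>\<phi>. iexp (W \<phi>)" v] c by simp
    have e': "(\<integral>\<phi>. cnj (iexp (W (translate v \<phi>))) \<partial>P) = c" for v
      unfolding Bochner_Integration.integral_cnj e by simp
    have [measurable]: "(\<lambda>\<phi>. cnj (iexp (W (translate v \<phi>)))) \<in> borel_measurable P" for v
      by (intro measurable_compose[OF _ borel_measurable_continuous_onI[of cnj]] continuous_intros) auto
    have "expectation (\<lambda>\<phi>. ?D \<phi> * ?D \<phi>) = expectation (\<lambda>\<phi>. W (translate u \<phi>) * W (translate u \<phi>) +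
        W (translate v \<phi>) * W (translate v \<phi>) - 2 * (W (translate u \<phi>) * W (translate v \<phi>)))"
      by (rule arg_cong[where f = "integral\<^sup>L P"]) (simp add: fun_eq_iff algebra_simps)
    also have "\<dots> = 2 * V - 2 * \<rho> u v"
      using is_comb_integrable_mult[OF combW combW] by (simp add: cov \<rho>V)
    finally have "(\<integral>\<phi>. iexp (?D \<phi>) \<partial>P) = exp (- (2 * V - 2 * \<rho> u v) / 2)"
      using is_comb_char[OF D] by simp
    also have "- (2 * V - 2 * \<rho> u v) / 2 = - V / 2 + - V / 2 + \<rho> u v" by simp
    also have "exp \<dots> = c\<^sup>2 * exp (\<rho> u v)"
      by (simp only: exp_add c_def power2_eq_square)
    finally have E: "(\<integral>\<phi>. iexp (?D \<phi>) \<partial>P) = complex_of_real (c\<^sup>2 * exp (\<rho> u v))" .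
    have i1: "integrable P (\<lambda>\<phi>. iexp (?D \<phi>))"
      by (rule integrable_iexp_comb[OF D])
    have i: "integrable P (\<lambda>\<phi>. iexp (W (translate v \<phi>)))" "integrable P (\<lambda>\<phi>. cnj (iexp (W (translate v \<phi>))))" for v
      using integrable_iexp_comb[OF combW[of v]] by (simp_all only: integrable_cnj)
    have "f u \<phi> * cnj (f v \<phi>) = iexp (?D \<phi>) - c * iexp (W (translate u \<phi>)) - c * cnj (iexp (W (translate v \<phi>))) + complex_of_real (c\<^sup>2)" for \<phi>
    proof -
      have "iexp (?D \<phi>) = iexp (W (translate u \<phi>)) * cnj (iexp (W (translate v \<phi>)))"
        unfolding cnj_iexp iexp_add[symmetric] by simp
      thus ?thesis by (simp only: f_def) (simp add: algebra_simps power2_eq_square)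
    qed
    hence "(\<integral>\<phi>. f u \<phi> * cnj (f v \<phi>) \<partial>P) = (\<integral>\<phi>. iexp (?D \<phi>) - c * iexp (W (translate u \<phi>)) - c * cnj (iexp (W (translate v \<phi>))) + complex_of_real (c\<^sup>2) \<partial>P)"
      by simp
    also have "\<dots> = complex_of_real (c\<^sup>2 * exp (\<rho> u v)) - c * c - c * c + complex_of_real (c\<^sup>2)"
    proof -
      have lin: "(\<integral>\<phi>. p \<phi> - c * q \<phi> - c * r \<phi> + K \<partial>P) = (\<integral>\<phi>. p \<phi> \<partial>P) - c * (\<integral>\<phi>. q \<phi> \<partial>P) - c * (\<integral>\<phi>. r \<phi> \<partial>P) + K"
        if "integrable P p" "integrable P q" "integrable P r"
        for p q r :: "(int ^ 'd \<Rightarrow> real) \<Rightarrow> complex" and K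
        using that prob_space by simp
      show ?thesis by (subst lin[OF i1 i]) (simp only: E e e' of_real_mult)
    qed
    finally show ?thesis by (simp add: algebra_simps power2_eq_square)
  qed
  have "norm z \<le> 0"
  proof (rule ccontr)
    assume "\<not> norm z \<le> 0"
    define e where "e = min ((norm z)\<^sup>2 / 4) 1"
    have e: "e > 0" "e \<le> 1" "e \<le> (norm z)\<^sup>2 / 4" using \<open>\<not> norm z \<le> 0\<close> by (auto simp: e_def)
    obtain C where C: "C > 0" "\<And>k (x :: int ^ 'd) y. 16 ^ k \<le> l1 (x - y) \<Longrightarrow> green x y \<le> C / 4 ^ k"
      using green_decay[OF dim] by blast
    define B where "B = (\<Sum>x\<in>S. \<Sum>y\<in>S. \<bar>a x * a y\<bar> * C)"
    have B: "B \<ge> 0" unfolding B_def using C by (intro sum_nonneg) auto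
    obtain k where k: "2 * B / e < 4 ^ k" using real_arch_pow[of 4 "2 * B / e"] by auto
    define D where "D = (\<Sum>x\<in>S. \<Sum>y\<in>S. l1 (x - y))"
    have D: "l1 (x - y) \<le> D" if "x \<in> S" "y \<in> S" for x y
    proof -
      have "l1 (x - y) \<le> (\<Sum>y\<in>S. l1 (x - y))" using that S by (intro member_le_sum) auto
      also have "\<dots> \<le> D" unfolding D_def using that S by (intro member_le_sum sum_nonneg) auto
      finally show ?thesis .
    qed
    have D0: "D \<ge> 0" unfolding D_def by (intro sum_nonneg) auto
    define i0 :: 'd where "i0 = undefined"
    \<comment> \<open>The spacing exceeds the diameter bound \<open>D\<close> of \<open>S\<close> by the scale at which covariances are small.\<close>
    define v where "v = (\<lambda>j :: nat. axis i0 (int j * (D + 16 ^ k)) :: int ^ 'd)"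
    have far: "16 ^ k \<le> l1 ((x + v i) - (y + v j))" if "x \<in> S" "y \<in> S" "i \<noteq> j" for x y i j
    proof -
      have "v i - v j = axis i0 ((int i - int j) * (D + 16 ^ k))"
        by (auto simp: v_def vec_eq_iff axis_def algebra_simps)
      hence "l1 (v i - v j) = \<bar>int i - int j\<bar> * (D + 16 ^ k)"
        using D0 by (simp add: abs_mult add_nonneg_nonneg)
      also have "\<dots> \<ge> 1 * (D + 16 ^ k)" using that D0 by (intro mult_right_mono) auto
      finally have "D + 16 ^ k \<le> l1 (v i - v j)" by simp
      also have "\<dots> \<le> l1 ((x + v i) - (y + v j)) + l1 (y - x)"
        using l1_triangle[of "(x + v i) - (y + v j)" "y - x"] by (simp add: algebra_simps)
      finally show ?thesis using D[OF that(2,1)] by simp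
    qed
    have \<rho>e: "\<bar>\<rho> (v i) (v j)\<bar> \<le> e / 2" if "i \<noteq> j" for i j
    proof -
      have "\<bar>\<rho> (v i) (v j)\<bar> \<le> (\<Sum>x\<in>S. \<Sum>y\<in>S. \<bar>a x * a y\<bar> * C / 4 ^ k)"
        unfolding \<rho>_def
      proof (intro order.trans[OF sum_abs] sum_mono)
        fix x y assume xy: "x \<in> S" "y \<in> S"
        have "\<bar>green (x + v i) (y + v j)\<bar> \<le> C / 4 ^ k"
          using green_nonneg[OF dim] C(2)[OF far[OF xy that]] by simp
        hence "\<bar>a x * a y\<bar> * \<bar>green (x + v i) (y + v j)\<bar> \<le> \<bar>a x * a y\<bar> * (C / 4 ^ k)"
          by (intro mult_left_mono) auto
        thus "\<bar>a x * a y * green (x + v i) (y + v j)\<bar> \<le> \<bar>a x * a y\<bar> * C / 4 ^ k"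
          by (simp add: abs_mult)
      qed
      also have "\<dots> = B / 4 ^ k" by (simp add: B_def sum_divide_distrib)
      also have "\<dots> \<le> e / 2" using k e by (simp add: field_simps)
      finally show ?thesis .
    qed
    obtain N :: nat where N: "N > 0" "4 / real N \<le> e"
    proof -
      obtain N :: nat where "4 / e < real N" using reals_Archimedean2 by blast
      moreover have "4 / e > 0" using e by simp
      ultimately have "real N > 0" by linarith
      moreover from this have "4 / real N \<le> e" using \<open>4 / e < real N\<close> e by (simp add: field_simps)
      ultimately show ?thesis using that by simp
    qed
    have "(norm z)\<^sup>2 \<le> 4 / real N + e"
    proof (rule nearly_orthogonal_average[where F = "\<lambda>j. f (v j)", OF _ A _ same _ N(1)])
      fix i j :: nat assume ij: "i \<noteq> j"
      have "norm (\<integral>\<phi>. f (v i) \<phi> * cnj (f (v j) \<phi>) \<partial>P) = \<bar>c\<^sup>2 * (exp (\<rho> (v i) (v j)) - 1)\<bar>"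
        unfolding corr by (simp only: norm_of_real)
      also have "\<dots> \<le> 1 * (2 * \<bar>\<rho> (v i) (v j)\<bar>)"
        unfolding abs_mult using c1 \<rho>e[OF ij] e
        by (intro mult_mono abs_exp_minus_1_le) (auto simp: power_le_one)
      also have "\<dots> \<le> e" using \<rho>e[OF ij] by simp
      finally show "norm (\<integral>\<phi>. f (v i) \<phi> * cnj (f (v j) \<phi>) \<partial>P) \<le> e" .
    qed (use fbd in auto)
    also have "\<dots> \<le> 2 * ((norm z)\<^sup>2 / 4)" using N e by simp
    finally show False using \<open>\<not> norm z \<le> 0\<close> by simp
  qed
  hence "z = 0" by simp
  have i: "integrable P (\<lambda>\<phi>. indicator A \<phi> * iexp (W \<phi>))" "integrable P (\<lambda>\<phi>. indicator A \<phi> :: complex)"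
    by (rule integrable_bounded_by_1, measurable, (simp add: norm_mult indicator_def)[1])+
  have "z = (\<integral>\<phi>. indicator A \<phi> * iexp (W \<phi>) - indicator A \<phi> * complex_of_real c \<partial>P)"
    by (simp add: z_def f_def tr0 right_diff_distrib)
  also have "\<dots> = (\<integral>\<phi>. indicator A \<phi> * iexp (W \<phi>) \<partial>P) - prob A * complex_of_real c"
    using i by (simp add: integral_complex_indicator[OF A])
  finally show ?thesis using \<open>z = 0\<close> c by simp
qed

text \<open>Conditioning on \<open>A\<close> leaves all characteristic functions unchanged, hence the law of the field. The conditional
  probability of \<open>A\<close> itself is \<open>1\<close>.\<close>
lemma zero_one_law:
  assumes A: "A \<in> events" and inv: "\<And>v. translate v -` A = A"
  shows "prob A = 0 \<or> prob A = 1"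
proof (cases "prob A = 0")
  case False
  note [measurable] = A
  let ?Q = "uniform_measure P A"
  have "?Q = P"
  proof (rule eq_P_if_cylinders)
    show "prob_space ?Q" using False
      by (intro prob_space_uniform_measure) (auto simp: emeasure_eq_measure)
    fix J and B :: "int ^ 'd \<Rightarrow> real set" assume J: "finite J" "\<And>j. j \<in> J \<Longrightarrow> B j \<in> sets borel"
    let ?C = "{\<phi>. \<forall>j\<in>J. \<phi> j \<in> B j}"
    note C [measurable] = cylinder_sets[OF J]
    have "(\<integral>\<phi>. indicator A \<phi> * (\<Prod>j\<in>J. indicator (B j) (\<phi> j)) \<partial>P) =
          (\<integral>\<phi>. complex_of_real (prob A) * (\<Prod>j\<in>J. indicator (B j) (\<phi> j)) \<partial>P)"
    proof (rule cylinder_law_determined[where I = UNIV])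
      fix S :: "(int ^ 'd) set" and a assume S: "finite S"
      show "(\<integral>\<phi>. indicator A \<phi> * iexp (linear_comb (\<lambda>j \<phi>. \<phi> j) S a \<phi>) \<partial>P) =
            (\<integral>\<phi>. complex_of_real (prob A) * iexp (linear_comb (\<lambda>j \<phi>. \<phi> j) S a \<phi>) \<partial>P)"
        using invariant_independent_of_char[OF A inv S, of a] by simp
    qed (use J prob_space_axioms in \<open>auto simp: indicator_def\<close>)
    hence "(\<integral>\<phi>. indicator (A \<inter> ?C) \<phi> \<partial>P) = complex_of_real (prob A * prob ?C)"
      by (simp add: prod_indicator_cylinder[OF J(1)] integral_complex_indicator[OF C] indicator_inter_arith)
    moreover have "(\<integral>\<phi>. indicator (A \<inter> ?C) \<phi> \<partial>P) = complex_of_real (prob (A \<inter> ?C))"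
      by (rule integral_complex_indicator[OF sets.Int[OF A C]])
    ultimately have "complex_of_real (prob (A \<inter> ?C)) = complex_of_real (prob A * prob ?C)" by metis
    hence "prob (A \<inter> ?C) = prob A * prob ?C" by (simp only: of_real_eq_iff)
    thus "measure ?Q ?C = prob ?C"
      using False by (subst measure_uniform_measure) (auto simp: emeasure_eq_measure)
  qed auto
  hence "prob A = measure ?Q A" by simp
  also have "\<dots> = 1" using False by (subst measure_uniform_measure) (auto simp: emeasure_eq_measure)
  finally show ?thesis ..
qed auto

lemma prob_has_infinite_cluster_1:
  assumes "eta P h \<noteq> 0"
  shows "prob (has_infinite_cluster P h) = 1"
proof -
  have "translate v -` has_infinite_cluster P h = has_infinite_cluster P h" for v
    unfolding has_infinite_cluster_eq vimage_UN translate_vimage_percolates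
    by auto (metis diff_add_cancel)
  hence "prob (has_infinite_cluster P h) = 0 \<or> prob (has_infinite_cluster P h) = 1"
    by (intro zero_one_law) auto
  moreover have "eta P h \<le> prob (has_infinite_cluster P h)"
    unfolding eta_def origin_percolates_eq
    by (intro finite_measure_mono) (auto simp: has_infinite_cluster_eq)
  moreover have "eta P h > 0" using assms measure_nonneg[of P] by (simp add: eta_def less_le)
  ultimately show ?thesis by auto
qed

end

section \<open>Percolation at negative levels\<close>
definition linked_to_sphere :: "int \<Rightarrow> (int ^ 'd) set \<Rightarrow> (int ^ 'd) set" where
  "linked_to_sphere N S = {x. \<exists>y. l1 y = N \<and> (x, y) \<in> connected_in (S \<inter> {x. l1 x \<le> N})}"

text \<open>The sites that remain unexplored when the components of \<open>S\<close> inside the ball of radius \<open>N\<close> that touch the sphere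
  are revealed together with their neighbours. The strict inequality counts the whole sphere as revealed.\<close>
definition hidden :: "int \<Rightarrow> (int ^ 'd) set \<Rightarrow> (int ^ 'd) set" where
  "hidden N S = {x. l1 x < N \<and> x \<notin> linked_to_sphere N S \<and> neighbours x \<inter> linked_to_sphere N S = {}}"

lemma l1_neighbour: "y \<in> neighbours x \<Longrightarrow> \<bar>l1 x - l1 y\<bar> \<le> 1"
  using l1_triangle_minus[of x 0 y] l1_triangle_minus[of y 0 x]
  by (simp add: neighbours_def adjacent_iff_l1 l1_minus_commute[of x])

lemma linked_to_sphere_step:
  assumes "y \<in> linked_to_sphere N S" "x \<in> S" "l1 x \<le> N" "y \<in> neighbours x"
  shows "x \<in> linked_to_sphere N S"
proof -
  obtain w where w: "l1 w = N" "(y, w) \<in> connected_in (S \<inter> {x. l1 x \<le> N})"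
    using assms(1) by (auto simp: linked_to_sphere_def)
  have "(x, y) \<in> connected_in (S \<inter> {x. l1 x \<le> N})"
    using assms w(2) by (auto simp: connected_in_def induced_edges_def neighbours_def)
  from connected_in_trans[OF this w(2)] w(1) show ?thesis by (auto simp: linked_to_sphere_def)
qed

lemma linked_to_sphere_start:
  assumes "x \<in> S" "l1 x = N"
  shows "x \<in> linked_to_sphere N S"
  using assms by (auto simp: linked_to_sphere_def intro!: exI[of _ x] connected_in_refl)

text \<open>Induction along the exploration, from the sphere inwards.\<close>
lemma linked_to_sphere_induct [consumes 1, case_names start step]:
  assumes x: "x \<in> linked_to_sphere N S"
    and start: "\<And>y. y \<in> S \<Longrightarrow> l1 y = N \<Longrightarrow> Q y"
    and step: "\<And>y z. Q y \<Longrightarrow> z \<in> S \<Longrightarrow> l1 z \<le> N \<Longrightarrow> y \<in> neighbours z \<Longrightarrow> Q z"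
  shows "Q x"
proof -
  let ?B = "S \<inter> {x. l1 x \<le> N}"
  obtain w where w: "l1 w = N" "(w, x) \<in> connected_in ?B"
    using x connected_in_sym by (auto simp: linked_to_sphere_def)
  have "(w, x) \<in> (induced_edges ?B)\<^sup>*" "w \<in> S" using w by (auto simp: connected_in_def)
  thus ?thesis
  proof (induction rule: rtrancl_induct)
    case base
    thus ?case using start w(1) by blast
  next
    case (step y z)
    have "z \<in> S" "l1 z \<le> N" "y \<in> neighbours z"
      using step.hyps(2) by (auto simp: induced_edges_def neighbours_def adjacent_sym[of z])
    thus ?case using assms(3) step by blast
  qed
qed

text \<open>A revealed neighbour \<open>y\<close> of an unexplored site cannot be linked to the sphere. If it were in \<open>S\<close>, it would have been
  linked, either by lying on the sphere or through the linked site that caused it to be revealed.\<close>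
lemma hidden_boundary:
  assumes x: "x \<in> hidden N S" and y: "y \<in> neighbours x" "y \<notin> hidden N S"
  shows "y \<notin> S"
proof
  assume yS: "y \<in> S"
  have xN: "l1 x < N" and nl: "y \<notin> linked_to_sphere N S" using x y(1) by (auto simp: hidden_def)
  have "l1 y \<le> N" using l1_neighbour[OF y(1)] xN by linarith
  moreover have "l1 y \<noteq> N" using linked_to_sphere_start[OF yS] nl by blast
  ultimately have lt: "l1 y < N" by simp
  then obtain w where "w \<in> neighbours y" "w \<in> linked_to_sphere N S"
    using y(2) nl by (auto simp: hidden_def)
  thus False using linked_to_sphere_step[of w N S y] yS lt nl by simp
qed

lemma linked_to_sphere_not_hidden: "x \<in> linked_to_sphere N S \<Longrightarrow> x \<notin> hidden N S"
  by (simp add: hidden_def)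

text \<open>The unexplored region is a stopping set: whether it equals a given set is decided by \<open>S\<close> outside that set, since the
  exploration never looks inside. Both inclusions between the linked sites follow the exploration inwards.\<close>
lemma hidden_local:
  assumes eq: "S - hidden N S = S' - hidden N S"
  shows "hidden N S' = hidden N S"
proof -
  have "x \<in> linked_to_sphere N S'" if "x \<in> linked_to_sphere N S" for x
  proof -
    from that have "x \<in> linked_to_sphere N S \<and> x \<in> linked_to_sphere N S'"
    proof (induction rule: linked_to_sphere_induct)
      case (start y)
      thus ?case using eq linked_to_sphere_start[of y S N] linked_to_sphere_not_hidden[of y N S]
        by (auto intro: linked_to_sphere_start)
    next
      case (step y z)
      hence "z \<in> linked_to_sphere N S" using linked_to_sphere_step by blast
      moreover from this have "z \<in> S'" using eq step linked_to_sphere_not_hidden[of z N S] by auto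
      ultimately show ?case using step linked_to_sphere_step by blast
    qed
    thus ?thesis ..
  qed
  moreover have "x \<in> linked_to_sphere N S" if "x \<in> linked_to_sphere N S'" for x
    using that
  proof (induction rule: linked_to_sphere_induct)
    case (start y)
    hence "y \<notin> hidden N S" by (simp add: hidden_def)
    thus ?case using eq start by (auto intro: linked_to_sphere_start)
  next
    case (step y z)
    hence "z \<notin> hidden N S" by (auto simp: hidden_def)
    hence "z \<in> S" using eq step by auto
    thus ?case using step linked_to_sphere_step by blast
  qed
  ultimately have "linked_to_sphere N S' = linked_to_sphere N S" by blast
  thus ?thesis by (simp add: hidden_def)
qed

lemma hidden_restrict: "hidden N (S \<inter> {x. l1 x \<le> N}) = hidden N S"
  by (simp add: hidden_def linked_to_sphere_def)

lemma not_linked_not_hidden: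
  assumes "x \<notin> linked_to_sphere N S" "x \<notin> hidden N S" "l1 x < N"
  shows "x \<notin> S"
  using assms linked_to_sphere_step[of _ N S x] by (force simp: hidden_def)

lemma discrete_maximum_principle:
  fixes V :: "(int ^ 'd) set"
  assumes V: "finite V"
    and harm: "\<And>x. x \<in> V \<Longrightarrow> v x = neighbour_mean v x"
    and bdry: "\<And>x y. x \<in> V \<Longrightarrow> y \<in> neighbours x \<Longrightarrow> y \<notin> V \<Longrightarrow> v y \<le> c"
    and x: "x \<in> V"
  shows "v x \<le> c"
proof (rule ccontr)
  assume "\<not> v x \<le> c"
  define m where "m = Max (v ` V)"
  have le: "v y \<le> m" if "y \<in> V" for y unfolding m_def using V that by auto
  have m: "m > c" using le[OF x] \<open>\<not> v x \<le> c\<close> by simp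
  obtain x0 where x0: "x0 \<in> V" "v x0 = m"
  proof -
    have "m \<in> v ` V" unfolding m_def using V x by (intro Max_in) auto
    thus ?thesis using that by auto
  qed
  have step: "y \<in> V \<and> v y = m" if "z \<in> V" "v z = m" "y \<in> neighbours z" for y z
  proof -
    have nn: "m - v y \<ge> 0" if "y \<in> neighbours z" for y
      using bdry[OF \<open>z \<in> V\<close> that] le[of y] m by (cases "y \<in> V") auto
    have "(\<Sum>y\<in>neighbours z. v y) = m * card (neighbours z)"
      using harm[OF that(1)] that(2) by (simp add: neighbour_mean_def card_neighbours field_simps)
    hence "(\<Sum>y\<in>neighbours z. m - v y) = 0" by (simp add: sum_subtractf)
    hence "v y = m" using nn that(3) by (simp add: sum_nonneg_eq_0_iff)
    thus ?thesis using bdry[OF that(1,3)] m by auto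
  qed
  define i0 :: 'd where "i0 = undefined"
  have "x0 + axis i0 (int k) \<in> V \<and> v (x0 + axis i0 (int k)) = m" for k
  proof (induction k)
    case 0
    have "axis i0 (0 :: int) = 0" by (simp add: vec_eq_iff axis_def)
    with x0 show ?case by (simp only: of_nat_0 add_0_right simp_thms)
  next
    case (Suc k)
    have "x0 + axis i0 (int (Suc k)) = (x0 + axis i0 (int k)) + axis i0 1"
      by (simp add: vec_eq_iff axis_def)
    hence "x0 + axis i0 (int (Suc k)) \<in> neighbours (x0 + axis i0 (int k))"
      by (simp add: neighbours_def adjacent_iff_l1 l1_minus_commute[of "x0 + axis i0 (int k)"])
    thus ?case using Suc step by blast
  qed
  hence "range (\<lambda>k. x0 + axis i0 (int k)) \<subseteq> V" by auto
  moreover have "infinite (range (\<lambda>k. x0 + axis i0 (int k)))"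
    by (rule range_inj_infinite) (auto simp: inj_on_def axis_eq_axis)
  ultimately show False using V by (auto dest: finite_subset)
qed

context gff begin

text \<open>By \<open>hidden_local\<close> the event that the unexplored region equals \<open>V\<close> depends on the excursion set in the finite
  set \<open>B\<close> only. This exhibits it as a disjoint union of cylinders over coordinates outside \<open>V\<close>.\<close>
lemma hidden_event_decomposition:
  fixes V :: "(int ^ 'd) set" and N :: int and h :: real
  defines "B \<equiv> {x. l1 x \<le> N} - V"
  defines "cyl \<equiv> \<lambda>T. {\<phi> :: int ^ 'd \<Rightarrow> real. \<forall>x\<in>B. \<phi> x \<in> (if x \<in> T then {h..} else {..<h})}"
  shows "{\<phi>. hidden N (excursion_set h \<phi>) = V} = (\<Union>T\<in>{T. T \<subseteq> B \<and> hidden N T = V}. cyl T)" 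
    and "disjoint_family_on cyl {T. T \<subseteq> B \<and> hidden N T = V}"
proof -
  have cyl: "\<phi> \<in> cyl T \<longleftrightarrow> excursion_set h \<phi> \<inter> B = T" if "T \<subseteq> B" for \<phi> T
    using that by (auto simp: cyl_def excursion_set_def split: if_splits)
  have hid: "hidden N (excursion_set h \<phi>) = V \<longleftrightarrow> hidden N (excursion_set h \<phi> \<inter> B) = V" for \<phi>
  proof -
    define E where "E = excursion_set h \<phi> \<inter> {x. l1 x \<le> N}"
    have "E - V = (excursion_set h \<phi> \<inter> B) - V" by (auto simp: E_def B_def)
    hence "hidden N E = V \<longleftrightarrow> hidden N (excursion_set h \<phi> \<inter> B) = V"
      using hidden_local[of E N] hidden_local[of "excursion_set h \<phi> \<inter> B" N] by metis
    thus ?thesis by (simp add: E_def hidden_restrict)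
  qed
  show "{\<phi>. hidden N (excursion_set h \<phi>) = V} = (\<Union>T\<in>{T. T \<subseteq> B \<and> hidden N T = V}. cyl T)"
    unfolding hid by (auto simp: cyl) 
  show "disjoint_family_on cyl {T. T \<subseteq> B \<and> hidden N T = V}"
    unfolding disjoint_family_on_def
  proof (intro ballI impI equals0I)
    fix T T' \<phi>
    assume "T \<in> {T. T \<subseteq> B \<and> hidden N T = V}" "T' \<in> {T. T \<subseteq> B \<and> hidden N T = V}" "T \<noteq> T'" "\<phi> \<in> cyl T \<inter> cyl T'"
    hence "excursion_set h \<phi> \<inter> B = T" "excursion_set h \<phi> \<inter> B = T'" using cyl by auto
    with \<open>T \<noteq> T'\<close> show False by blast
  qed
qed

lemma hidden_event:
  fixes V :: "(int ^ 'd) set"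
  shows "{\<phi>. hidden N (excursion_set h \<phi>) = V} \<in> events"
    and "is_comb Y \<Longrightarrow> (\<And>z. z \<notin> V \<Longrightarrow> expectation (\<lambda>\<phi>. Y \<phi> * \<phi> z) = 0) \<Longrightarrow>
      expectation (\<lambda>\<phi>. Y \<phi> * indicator {\<phi>. hidden N (excursion_set h \<phi>) = V} \<phi>) = 0"
proof -
  let ?B = "{x. l1 x \<le> N} - V"
  let ?T = "{T. T \<subseteq> ?B \<and> hidden N T = V}"
  let ?cyl = "\<lambda>T. {\<phi> :: int ^ 'd \<Rightarrow> real. \<forall>x\<in>?B. \<phi> x \<in> (if x \<in> T then {h..} else {..<h})}"
  note dec = hidden_event_decomposition[where V = V and N = N and h = h]
  have fB: "finite ?B" by auto
  have fT: "finite ?T" by (rule finite_subset[of _ "Pow ?B"]) (use fB in auto)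
  have cyl: "?cyl T \<in> events" for T using fB by (intro cylinder_sets) auto
  show "{\<phi>. hidden N (excursion_set h \<phi>) = V} \<in> events"
    unfolding dec(1) using fT cyl by (intro sets.finite_UN) auto
  assume Y: "is_comb Y" and orth: "\<And>z. z \<notin> V \<Longrightarrow> expectation (\<lambda>\<phi>. Y \<phi> * \<phi> z) = 0"
  have i: "integrable P (\<lambda>\<phi>. Y \<phi> * indicator (?cyl T) \<phi>)" for T
    using is_comb_integrable[OF Y] cyl by (intro integrable_real_mult_indicator)
  have "expectation (\<lambda>\<phi>. Y \<phi> * indicator {\<phi>. hidden N (excursion_set h \<phi>) = V} \<phi>) =
      expectation (\<lambda>\<phi>. \<Sum>T\<in>?T. Y \<phi> * indicator (?cyl T) \<phi>)"
    unfolding dec(1) by (simp only: indicator_UN_disjoint[OF fT dec(2)] sum_distrib_left)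
  also have "\<dots> = (\<Sum>T\<in>?T. expectation (\<lambda>\<phi>. Y \<phi> * indicator (?cyl T) \<phi>))"
    by (rule Bochner_Integration.integral_sum) (rule i)
  also have "\<dots> = 0"
    by (intro sum.neutral ballI uncorrelated_mean_zero[OF Y] fB) (auto intro: orth)
  finally show "expectation (\<lambda>\<phi>. Y \<phi> * indicator {\<phi>. hidden N (excursion_set h \<phi>) = V} \<phi>) = 0" .
qed

text \<open>The Markov property in the form needed here. For \<open>x\<close> in \<open>V\<close> the variable \<open>Y\<close>, the value at \<open>x\<close> minus the mean over the
  neighbours, is uncorrelated with the field at all other sites, because the Green function is harmonic off the
  diagonal. Hence the expectations of the field restricted to the event form a harmonic function on \<open>V\<close>, and on the
  boundary of \<open>V\<close> they are at most \<open>h * prob A\<close> by \<open>hidden_boundary\<close>.\<close>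
lemma expectation_hidden_le:
  fixes V :: "(int ^ 'd) set" and N :: int and h :: real
  assumes V: "finite V" and x: "x \<in> V"
  defines "A \<equiv> {\<phi>. hidden N (excursion_set h \<phi>) = V}"
  shows "expectation (\<lambda>\<phi>. \<phi> x * indicator A \<phi>) \<le> h * prob A"
proof -
  have A [measurable]: "A \<in> events" unfolding A_def by (rule hidden_event)
  have i: "integrable P (\<lambda>\<phi>. \<phi> y * indicator A \<phi>)" for y
    using is_comb_integrable[OF is_comb_coord] A by (intro integrable_real_mult_indicator)
  show ?thesis
  proof (rule discrete_maximum_principle[OF V _ _ x, where v = "\<lambda>x. expectation (\<lambda>\<phi>. \<phi> x * indicator A \<phi>)"])
    fix x assume x: "x \<in> V"
    define Y where "Y = (\<lambda>\<phi> :: int ^ 'd \<Rightarrow> real. \<phi> x + (- 1 / real (card (neighbours x))) * (\<Sum>y\<in>neighbours x. \<phi> y))"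
    have Y: "is_comb Y" unfolding Y_def
      by (intro is_comb_add is_comb_scale is_comb_sum is_comb_coord) auto
    have i2: "integrable P (\<lambda>\<phi>. \<phi> y * \<phi> z)" for y z by (intro is_comb_integrable_mult is_comb_coord)
    have "expectation (\<lambda>\<phi>. Y \<phi> * \<phi> z) = 0" if "z \<notin> V" for z
    proof -
      have "expectation (\<lambda>\<phi>. Y \<phi> * \<phi> z) =
        expectation (\<lambda>\<phi>. \<phi> x * \<phi> z + (- 1 / real (card (neighbours x))) * (\<Sum>y\<in>neighbours x. \<phi> y * \<phi> z))"
        by (rule arg_cong[where f = "integral\<^sup>L P"]) (simp add: fun_eq_iff Y_def left_diff_distrib sum_distrib_right)
      also have "\<dots> = green x z - neighbour_mean (\<lambda>y. green y z) x"
        using i2 by (simp add: covariance neighbour_mean_def)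
      also have "\<dots> = of_bool (z = x)"
        using green_eq[OF dim, of z x] by (simp add: green_commute[of _ z])
      finally show ?thesis using that x by auto
    qed
    hence "expectation (\<lambda>\<phi>. Y \<phi> * indicator A \<phi>) = 0"
      unfolding A_def by (intro hidden_event(2) Y)
    moreover have "expectation (\<lambda>\<phi>. Y \<phi> * indicator A \<phi>) =
       expectation (\<lambda>\<phi>. \<phi> x * indicator A \<phi> + (- 1 / real (card (neighbours x))) * (\<Sum>y\<in>neighbours x. \<phi> y * indicator A \<phi>))"
      by (rule arg_cong[where f = "integral\<^sup>L P"]) (simp add: fun_eq_iff Y_def left_diff_distrib sum_distrib_right)
    moreover have "\<dots> = expectation (\<lambda>\<phi>. \<phi> x * indicator A \<phi>) - neighbour_mean (\<lambda>y. expectation (\<lambda>\<phi>. \<phi> y * indicator A \<phi>)) x"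
    proof -
      have lin: "expectation (\<lambda>\<phi>. f \<phi> + c * (\<Sum>y\<in>S. g y \<phi>)) = expectation f + c * (\<Sum>y\<in>S. expectation (g y))"
        if "integrable P f" "\<And>y. integrable P (g y)" 
        for f :: "(int ^ 'd \<Rightarrow> real) \<Rightarrow> real" and c S and g :: "int ^ 'd \<Rightarrow> (int ^ 'd \<Rightarrow> real) \<Rightarrow> real"
        using that by (simp add: Bochner_Integration.integral_sum)
      show ?thesis by (subst lin[OF i i]) (simp add: neighbour_mean_def)
    qed
    ultimately show "expectation (\<lambda>\<phi>. \<phi> x * indicator A \<phi>) = neighbour_mean (\<lambda>y. expectation (\<lambda>\<phi>. \<phi> y * indicator A \<phi>)) x"
      by simp
  next
    fix x y assume xy: "x \<in> V" "y \<in> neighbours x" "y \<notin> V"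
    have "expectation (\<lambda>\<phi>. \<phi> y * indicator A \<phi>) \<le> expectation (\<lambda>\<phi>. h * indicator A \<phi>)"
    proof (rule integral_mono[OF i])
      show "integrable P (\<lambda>\<phi>. h * indicator A \<phi>)"
        using A by (intro integrable_mult_right integrable_real_indicator) (auto simp: emeasure_eq_measure)
      fix \<phi> :: "int ^ 'd \<Rightarrow> real"
      have "\<phi> y < h" if "\<phi> \<in> A"
        using hidden_boundary[of x N "excursion_set h \<phi>" y] that xy by (auto simp: A_def excursion_set_def)
      thus "\<phi> y * indicator A \<phi> \<le> h * indicator A \<phi>" by (auto simp: indicator_def)
    qed
    also have "\<dots> = h * prob A" using A by simp
    finally show "expectation (\<lambda>\<phi>. \<phi> y * indicator A \<phi>) \<le> h * prob A" .
  qed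
qed

text \<open>If the origin is not linked to the sphere, it is either unexplored, and the event splits according to the
  unexplored region, or it was revealed as a site below \<open>h\<close>, where the integrand is negative.\<close>
lemma expectation_disconnected_le:
  fixes N :: int and h :: real
  assumes N: "N > 0"
  defines "D \<equiv> {\<phi>. 0 \<notin> linked_to_sphere N (excursion_set h \<phi>)}"
  shows "D \<in> events" "expectation (\<lambda>\<phi>. (\<phi> 0 - h) * indicator D \<phi>) \<le> 0"
proof -
  have "Measurable.pred P (\<lambda>\<phi>. \<not> (\<exists>y. l1 y = N \<and> (0, y) \<in> connected_in (excursion_set h \<phi> \<inter> {x. l1 x \<le> N})))"
    by measurable
  thus D: "D \<in> events" by (simp add: D_def linked_to_sphere_def pred_def)
  define A where "A = (\<lambda>V. {\<phi>. hidden N (excursion_set h \<phi>) = (V :: (int ^ 'd) set)})"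
  define VV where "VV = {V :: (int ^ 'd) set. V \<subseteq> {x. l1 x \<le> N} \<and> 0 \<in> V}"
  have fVV: "finite VV" unfolding VV_def by (rule finite_subset[of _ "Pow {x. l1 x \<le> N}"]) auto
  have A: "A V \<in> events" for V unfolding A_def by (rule hidden_event)
  have i0: "integrable P (\<lambda>\<phi>. \<phi> 0 - h)" using is_comb_integrable[OF is_comb_coord] by simp
  have i: "integrable P (\<lambda>\<phi>. (\<phi> 0 - h) * indicator (A V) \<phi>)" for V
    using i0 A by (intro integrable_real_mult_indicator)
  have iA: "integrable P (\<lambda>\<phi>. \<phi> 0 * indicator (A V) \<phi>)" for V
    using is_comb_integrable[OF is_comb_coord] A by (intro integrable_real_mult_indicator)
  have "expectation (\<lambda>\<phi>. (\<phi> 0 - h) * indicator D \<phi>) \<le> expectation (\<lambda>\<phi>. \<Sum>V\<in>VV. (\<phi> 0 - h) * indicator (A V) \<phi>)"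
  proof (rule integral_mono)
    show "integrable P (\<lambda>\<phi>. (\<phi> 0 - h) * indicator D \<phi>)"
      using i0 D by (intro integrable_real_mult_indicator)
    show "integrable P (\<lambda>\<phi>. \<Sum>V\<in>VV. (\<phi> 0 - h) * indicator (A V) \<phi>)" using i by auto
    fix \<phi> :: "int ^ 'd \<Rightarrow> real"
    let ?H = "hidden N (excursion_set h \<phi>)"
    have "(\<Sum>V\<in>VV. (\<phi> 0 - h) * indicator (A V) \<phi>) = (\<Sum>V\<in>VV. if V = ?H then \<phi> 0 - h else 0)"
      by (intro sum.cong) (auto simp: A_def indicator_def)
    also have "\<dots> = (if ?H \<in> VV then \<phi> 0 - h else 0)" using fVV by simp
    also have "?H \<in> VV \<longleftrightarrow> 0 \<in> ?H" by (auto simp: VV_def hidden_def)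
    finally have sum: "(\<Sum>V\<in>VV. (\<phi> 0 - h) * indicator (A V) \<phi>) = (if 0 \<in> ?H then \<phi> 0 - h else 0)" .
    have "\<phi> 0 < h" if "\<phi> \<in> D" "0 \<notin> ?H"
      using not_linked_not_hidden[of 0 N "excursion_set h \<phi>"] that N
      by (auto simp: D_def excursion_set_def)
    moreover have "0 \<notin> ?H" if "\<phi> \<notin> D" using that by (auto simp: D_def hidden_def)
    ultimately show "(\<phi> 0 - h) * indicator D \<phi> \<le> (\<Sum>V\<in>VV. (\<phi> 0 - h) * indicator (A V) \<phi>)"
      unfolding sum by (auto simp: indicator_def)
  qed
  also have "\<dots> = (\<Sum>V\<in>VV. expectation (\<lambda>\<phi>. (\<phi> 0 - h) * indicator (A V) \<phi>))"
    by (rule Bochner_Integration.integral_sum) (rule i)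
  also have "\<dots> \<le> 0"
  proof (rule sum_nonpos)
    fix V assume "V \<in> VV"
    hence V: "finite V" "0 \<in> V" by (auto simp: VV_def intro: finite_subset)
    have "expectation (\<lambda>\<phi>. (\<phi> 0 - h) * indicator (A V) \<phi>) =
        expectation (\<lambda>\<phi>. \<phi> 0 * indicator (A V) \<phi>) - h * prob (A V)"
      unfolding left_diff_distrib using iA[of V] A[of V]
      by (subst Bochner_Integration.integral_diff)
         (auto intro!: integrable_mult_right integrable_real_indicator simp: emeasure_eq_measure)
    also have "\<dots> \<le> 0" using expectation_hidden_le[OF V, of N h] by (simp add: A_def)
    finally show "expectation (\<lambda>\<phi>. (\<phi> 0 - h) * indicator (A V) \<phi>) \<le> 0" .
  qed
  finally show "expectation (\<lambda>\<phi>. (\<phi> 0 - h) * indicator D \<phi>) \<le> 0" .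
qed

text \<open>The events \<open>D n\<close> that the origin is separated from the sphere of radius \<open>n + 1\<close> eventually hold almost surely, so
  the inequality \<open>E[(\<phi>\<^sub>0 - h) 1\<^bsub>D n\<^esub>] \<le> 0\<close> passes to the limit \<open>- h \<le> 0\<close>.\<close>
lemma eta_zero_imp_nonneg:
  assumes eta: "eta P h = 0"
  shows "h \<ge> 0"
proof -
  define D where "D = (\<lambda>n :: nat. {\<phi> :: int ^ 'd \<Rightarrow> real. 0 \<notin> linked_to_sphere (int (Suc n)) (excursion_set h \<phi>)})"
  have D [measurable]: "D n \<in> events" for n
    unfolding D_def by (rule expectation_disconnected_le(1)) simp
  have i0: "integrable P (\<lambda>\<phi>. \<phi> 0)" by (intro is_comb_integrable is_comb_coord)
  have "percolates_at h 0 \<in> null_sets P"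
    using eta by (intro null_setsI) (auto simp: emeasure_eq_measure prob_percolates_at)
  hence ae: "AE \<phi> in P. \<phi> \<notin> percolates_at h 0" by (rule AE_not_in)
  have ev: "eventually (\<lambda>n. \<phi> \<in> D n) sequentially" if np: "\<phi> \<notin> percolates_at h 0" for \<phi>
  proof -
    let ?C = "connected_in (excursion_set h \<phi>) `` {0}"
    obtain M :: nat where M: "\<And>y. y \<in> ?C \<Longrightarrow> \<not> int M \<le> l1 (y - 0)"
      using np infinite_iff_unbounded_l1[of ?C 0] by (auto simp: percolates_at_def)
    have "\<phi> \<in> D n" if "n \<ge> M" for n
    proof -
      have "y \<in> ?C" if "(0, y) \<in> connected_in (excursion_set h \<phi> \<inter> B)" for y B
        using that connected_in_mono[of "excursion_set h \<phi> \<inter> B" "excursion_set h \<phi>"] by auto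
      hence "l1 y < int M" if "(0, y) \<in> connected_in (excursion_set h \<phi> \<inter> B)" for y B
        using M[of y] that by force
      thus ?thesis using that by (force simp: D_def linked_to_sphere_def)
    qed
    thus ?thesis by (auto simp: eventually_sequentially)
  qed
  have "(\<lambda>n. expectation (\<lambda>\<phi>. (\<phi> 0 - h) * indicator (D n) \<phi>)) \<longlonglongrightarrow> expectation (\<lambda>\<phi>. \<phi> 0 - h)"
  proof (rule integral_dominated_convergence[where w = "\<lambda>\<phi>. \<bar>\<phi> 0 - h\<bar>"])
    show "AE \<phi> in P. (\<lambda>n. (\<phi> 0 - h) * indicator (D n) \<phi>) \<longlonglongrightarrow> \<phi> 0 - h"
      using ae
    proof eventually_elim
      case (elim \<phi>)
      show ?case
        by (rule tendsto_eventually, rule eventually_mono[OF ev[OF elim]]) simp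
    qed
  qed (use i0 in \<open>auto simp: indicator_def\<close>)
  hence "expectation (\<lambda>\<phi>. \<phi> 0 - h) \<le> 0"
    by (rule LIMSEQ_le_const2) (auto simp: D_def intro!: expectation_disconnected_le(2))
  moreover have "expectation (\<lambda>\<phi>. \<phi> 0 - h) = - h"
    using i0 is_comb_gaussian(2)[OF is_comb_coord[of 0]] prob_space by simp
  ultimately show ?thesis by simp
qed

end

section \<open>The phase transition\<close>
theorem corollary2p7:
  fixes P :: "(int ^ 'd \<Rightarrow> real) measure"
  assumes "CARD('d) \<ge> 3"
    and "gff_law P"
  shows "0 \<le> h_star P \<and> h_star P < \<infinity> \<and>
    (\<forall>h :: real.
      (ereal h < h_star P \<longrightarrow> measure P (has_infinite_cluster P h) = 1) \<and>
      (ereal h > h_star P \<longrightarrow> measure P (has_infinite_cluster P h) = 0))"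
proof -
  interpret prob_space P
    using assms(2) by (simp add: gff_law_def centered_gaussian_field_def)
  interpret gff P by unfold_locales (rule assms)+
  have "0 \<le> h_star P"
    unfolding h_star_def by (rule Inf_greatest) (auto intro: eta_zero_imp_nonneg)
  moreover have "h_star P < \<infinity>"
  proof -
    obtain h where "eta P h = 0" using eta_zero_high_level by blast
    hence "h_star P \<le> ereal h" unfolding h_star_def by (intro Inf_lower) auto
    thus ?thesis by auto
  qed
  moreover have "measure P (has_infinite_cluster P h) = 1" if "ereal h < h_star P" for h
  proof (rule prob_has_infinite_cluster_1)
    show "eta P h \<noteq> 0"
    proof
      assume "eta P h = 0"
      hence "h_star P \<le> ereal h" unfolding h_star_def by (intro Inf_lower) auto
      thus False using that by simp
    qed
  qed
  moreover have "measure P (has_infinite_cluster P h) = 0" if "ereal h > h_star P" for h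
  proof (rule prob_has_infinite_cluster_0)
    have "\<exists>a\<in>ereal ` {h. eta P h = 0}. a < ereal h"
      using that unfolding h_star_def Inf_less_iff .
    then obtain h' where "eta P h' = 0" "h' < h" by auto
    thus "eta P h = 0" using eta_antimono[of h' h] measure_nonneg[of P] by (simp add: eta_def antisym)
  qed
  ultimately show ?thesis by blast
qed

end
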